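(* Let $C$ be a category equipped with two monoidal structures $(C,\otimes_1,I_1)$ and $(C,\otimes_2,I_2)$, and suppose that the identity functor $1:C\to C$ is given the structure of an oplax monoidal functor $(C,\otimes_1,I_1)\to(C,\otimes_2,I_2)$, with structure maps $f_{x,y}:x\otimes_1 y\to x\otimes_2 y$ and $f_0:I_1\to I_2$. Assume that $C$ has an orthogonal factorisation system $(\mathcal E,\mathcal M)$ such that - if $f,f'\in\mathcal E$ then $f\otimes_1 f'\in\mathcal E$, and - if $g,g'\in\mathcal M$ then $g\otimes_2 g'\in\mathcal M$. Then factoring each $f_{x,y}$ and $f_0$ as an $\mathcal E$-map followed by an $\mathcal M$-map, $$x\otimes_1 y\xrightarrow{e_{x,y}}x\otimes y\xrightarrow{m_{x,y}}x\otimes_2 y,\qquad I_1\xrightarrow{e_0}I\xrightarrow{m_0}I_2,$$ gives a functor $\otimes:C^2\to C$, an object $I\in C$, and natural transformations $\otimes_1\overset{e}{\Rightarrow}\otimes\overset{m}{\Rightarrow}\otimes_2$ with components $e_{x,y}$ and $m_{x,y}$. Furthermore, $C$ admits a unique monoidal structure with tensor product $\otimes$ and unit object $I$ such that $e$ (together with $e_0$) and $m$ (together with $m_0$) each give oplax monoidal structures to the identity functor, $(C,\otimes_1,I_1)\to(C,\otimes,I)$ and $(C,\otimes,I)\to(C,\otimes_2,I_2)$ respectively. If the monoidal structures $\otimes_1,\otimes_2$ are additionally equipped with symmetries (resp. braidings), and $f_{x,y},f_0$ give the identity functor the structure of an oplax symmetric (resp. braided) monoidal functor, then $(C,\otimes,I)$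 can additionally be given a unique symmetry (resp. braiding) such that $e$ and $m$ each give oplax symmetric (resp. braided) monoidal structures to the identity functor.
   Context: An oplax monoidal functor $F:(C,\otimes,I,a,l,r)\to(D,\oplus,J,a,l,r)$ between monoidal categories (with $a:(x\otimes y)\otimes z\to x\otimes(y\otimes z)$, $l:I\otimes x\to x$, $r:x\otimes I\to x$, and similarly in $D$) is a functor $F$ together with a morphism $\phi_0:F(I)\to J$ and a natural transformation $\phi_{x,y}:F(x\otimes y)\to Fx\oplus Fy$ such that for all $x,y,z$: - $l\circ(\phi_0\oplus 1)\circ\phi_{I,x}=F(l)$ as maps $F(I\otimes x)\to Fx$; - $r\circ(1\oplus\phi_0)\circ\phi_{x,I}=F(r)$ as maps $F(x\otimes I)\to Fx$; - $(1\oplus\phi_{y,z})\circ\phi_{x,y\otimes z}\circ F(a)=a\circ(\phi_{x,y}\oplus 1)\circ\phi_{x\otimes y,z}$ as maps $F((x\otimes y)\otimes z)\to Fx\oplus(Fy\oplus Fz)$. If $C,D$ are symmetric (resp. braided) with symmetries (resp. braidings) denoted $\beta$, then $F$ is oplax symmetric (resp. braided) monoidal if moreover $\beta\circ\phi_{x,y}=\phi_{y,x}\circ F(\beta)$ as maps $F(x\otimes y)\to Fy\oplus Fx$. An oplax monoidal structure on the identity functor between two monoidal structures $(C,\otimes,I)$ and $(C,\otimes',I')$ on the same category $C$ is the case $F=1_C$: maps $x\otimes y\to x\otimes' y$, natural in $x,y$, and a map $I\to I'$, satisfying these axioms. In a category $C$, write $e\perp m$ if every commutative square with $e$ as one side and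 $m$ as the opposite side (say $e:A\to B$, $m:X\to D$, $u:A\to X$, $v:B\to D$ with $mu=ve$) has a unique diagonal filler $d:B\to X$ with $de=u$, $md=v$. An orthogonal factorisation system $(\mathcal E,\mathcal M)$ on $C$ consists of two classes of maps such that every morphism factors as a morphism in $\mathcal E$ followed by one in $\mathcal M$; $\mathcal E$ consists of all $f$ with $f\perp m$ for all $m\in\mathcal M$; and $\mathcal M$ consists of all $g$ with $e\perp g$ for all $e\in\mathcal E$. *)

theory Defs
  imports Main
begin

section \<open>Categories, functors, natural transformations\<close>

text \<open>
  Objects and arrows live in carrier sets; the fields are meaningful only on these carriers.
  Accordingly, two families of arrows indexed by objects are "the same" if they agree on the
  carrier.
\<close>

record ('o, 'm) cat =
  Obj :: "'o set"
  Arr :: "'m set"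
  Dom :: "'m \<Rightarrow> 'o"
  Cod :: "'m \<Rightarrow> 'o"
  Ident :: "'o \<Rightarrow> 'm" ("\<one>\<index>")
  Comp :: "'m \<Rightarrow> 'm \<Rightarrow> 'm" (infixr "\<cdot>\<index>" 60)

definition hom :: "('o, 'm) cat \<Rightarrow> 'o \<Rightarrow> 'o \<Rightarrow> 'm set" where
  "hom C x y = {f \<in> Arr C. Dom C f = x \<and> Cod C f = y}"

locale category =
  fixes C :: "('o, 'm) cat" (structure)
  assumes Dom_in: "f \<in> Arr C \<Longrightarrow> Dom C f \<in> Obj C"
    and Cod_in: "f \<in> Arr C \<Longrightarrow> Cod C f \<in> Obj C"
    and Ident_in: "x \<in> Obj C \<Longrightarrow> \<one> x \<in> hom C x x"
    and Comp_in: "f \<in> hom C x y \<Longrightarrow> g \<in> hom C y z \<Longrightarrow> g \<cdot> f \<in> hom C x z"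
    and Comp_Ident: "f \<in> hom C x y \<Longrightarrow> f \<cdot> \<one> x = f"
    and Ident_Comp: "f \<in> hom C x y \<Longrightarrow> \<one> y \<cdot> f = f"
    and Comp_assoc: "f \<in> hom C w x \<Longrightarrow> g \<in> hom C x y \<Longrightarrow> h \<in> hom C y z \<Longrightarrow>
      (h \<cdot> g) \<cdot> f = h \<cdot> (g \<cdot> f)"

definition inverse_arrows :: "('o, 'm) cat \<Rightarrow> 'm \<Rightarrow> 'm \<Rightarrow> bool" where
  "inverse_arrows C f g \<longleftrightarrow>
    f \<in> Arr C \<and> g \<in> hom C (Cod C f) (Dom C f) \<and>
    g \<cdot>\<^bsub>C\<^esub> f = \<one>\<^bsub>C\<^esub> (Dom C f) \<and> f \<cdot>\<^bsub>C\<^esub> g = \<one>\<^bsub>C\<^esub> (Cod C f)"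

definition iso :: "('o, 'm) cat \<Rightarrow> 'm \<Rightarrow> bool" where
  "iso C f \<longleftrightarrow> (\<exists>g. inverse_arrows C f g)"

definition inv_arr :: "('o, 'm) cat \<Rightarrow> 'm \<Rightarrow> 'm" where
  "inv_arr C f = (THE g. inverse_arrows C f g)"

definition prod_cat :: "('o, 'm) cat \<Rightarrow> ('p, 'n) cat \<Rightarrow> ('o \<times> 'p, 'm \<times> 'n) cat"
    (infixr "\<times>\<^sub>c" 75) where
  "C \<times>\<^sub>c D =
    \<lparr>Obj = Obj C \<times> Obj D,
     Arr = Arr C \<times> Arr D,
     Dom = (\<lambda>(f, g). (Dom C f, Dom D g)),
     Cod = (\<lambda>(f, g). (Cod C f, Cod D g)),
     Ident = (\<lambda>(x, y). (\<one>\<^bsub>C\<^esub> x, \<one>\<^bsub>D\<^esub> y)),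
     Comp = (\<lambda>(g, g') (f, f'). (g \<cdot>\<^bsub>C\<^esub> f, g' \<cdot>\<^bsub>D\<^esub> f'))\<rparr>"

record ('o, 'm, 'p, 'n) ftor =
  fobj :: "'o \<Rightarrow> 'p"
  farr :: "'m \<Rightarrow> 'n"

locale cat_functor = C: category C + D: category D
  for C :: "('o, 'm) cat" and D :: "('p, 'n) cat" +
  fixes F :: "('o, 'm, 'p, 'n) ftor"
  assumes fobj_in: "x \<in> Obj C \<Longrightarrow> fobj F x \<in> Obj D"
    and farr_in: "f \<in> hom C x y \<Longrightarrow> farr F f \<in> hom D (fobj F x) (fobj F y)"
    and farr_Ident: "x \<in> Obj C \<Longrightarrow> farr F (\<one>\<^bsub>C\<^esub> x) = \<one>\<^bsub>D\<^esub> (fobj F x)"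
    and farr_Comp: "f \<in> hom C x y \<Longrightarrow> g \<in> hom C y z \<Longrightarrow>
      farr F (g \<cdot>\<^bsub>C\<^esub> f) = farr F g \<cdot>\<^bsub>D\<^esub> farr F f"

definition id_functor :: "('o, 'm, 'o, 'm) ftor" where
  "id_functor = \<lparr>fobj = (\<lambda>x. x), farr = (\<lambda>f. f)\<rparr>"

locale nat_trans = F: cat_functor C D F + G: cat_functor C D G
  for C :: "('o, 'm) cat" and D :: "('p, 'n) cat"
    and F :: "('o, 'm, 'p, 'n) ftor" and G :: "('o, 'm, 'p, 'n) ftor" +
  fixes \<eta> :: "'o \<Rightarrow> 'n"
  assumes component_in: "x \<in> Obj C \<Longrightarrow> \<eta> x \<in> hom D (fobj F x) (fobj G x)"
    and naturality: "f \<in> hom C x y \<Longrightarrow> \<eta> y \<cdot>\<^bsub>D\<^esub> farr F f = farr G f \<cdot>\<^bsub>D\<^esub> \<eta> x"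

locale nat_iso = nat_trans C D F G \<eta>
  for C :: "('o, 'm) cat" and D :: "('p, 'n) cat"
    and F :: "('o, 'm, 'p, 'n) ftor" and G :: "('o, 'm, 'p, 'n) ftor" and \<eta> :: "'o \<Rightarrow> 'n" +
  assumes component_iso: "x \<in> Obj C \<Longrightarrow> iso D (\<eta> x)"


section \<open>Monoidal, braided and symmetric monoidal categories\<close>

text \<open>
  Families indexed by pairs or triples of objects are indexed by the objects of
  \<open>C \<times>\<^sub>c C\<close> and \<open>C \<times>\<^sub>c C \<times>\<^sub>c C\<close>. The constraints have components
  \<open>assoc (x, y, z) : (x \<otimes> y) \<otimes> z \<rightarrow> x \<otimes> (y \<otimes> z)\<close>, \<open>lunit x : I \<otimes> x \<rightarrow> x\<close> and
  \<open>runit x : x \<otimes> I \<rightarrow> x\<close>.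
\<close>

record ('o, 'm) monoidal_structure =
  tensor :: "('o \<times> 'o, 'm \<times> 'm, 'o, 'm) ftor"
  unit_obj :: 'o
  assoc :: "'o \<times> 'o \<times> 'o \<Rightarrow> 'm"
  lunit :: "'o \<Rightarrow> 'm"
  runit :: "'o \<Rightarrow> 'm"

text \<open>\<open>x \<odot> y\<close> is the tensor product of objects, \<open>f \<otimes> g\<close> that of arrows.\<close>

abbreviation tensor_obj :: "('o, 'm) monoidal_structure \<Rightarrow> 'o \<Rightarrow> 'o \<Rightarrow> 'o" (infixr "\<odot>\<index>" 70)
  where "tensor_obj T x y \<equiv> fobj (tensor T) (x, y)"

abbreviation tensor_arr :: "('o, 'm) monoidal_structure \<Rightarrow> 'm \<Rightarrow> 'm \<Rightarrow> 'm" (infixr "\<otimes>\<index>" 70)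
  where "tensor_arr T f g \<equiv> farr (tensor T) (f, g)"

locale monoidal_category = category C
  for C :: "('o, 'm) cat" (structure) +
  fixes T :: "('o, 'm) monoidal_structure"
  assumes tensor_functor: "cat_functor (C \<times>\<^sub>c C) C (tensor T)"
    and unit_in: "unit_obj T \<in> Obj C"
    and assoc_iso: "nat_iso (C \<times>\<^sub>c C \<times>\<^sub>c C) C
      \<lparr>fobj = (\<lambda>(x, y, z). (x \<odot>\<^bsub>T\<^esub> y) \<odot>\<^bsub>T\<^esub> z), farr = (\<lambda>(f, g, h). (f \<otimes>\<^bsub>T\<^esub> g) \<otimes>\<^bsub>T\<^esub> h)\<rparr>
      \<lparr>fobj = (\<lambda>(x, y, z). x \<odot>\<^bsub>T\<^esub> (y \<odot>\<^bsub>T\<^esub> z)), farr = (\<lambda>(f, g, h). f \<otimes>\<^bsub>T\<^esub> (g \<otimes>\<^bsub>T\<^esub> h))\<rparr>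
      (assoc T)"
    and lunit_iso: "nat_iso C C
      \<lparr>fobj = (\<lambda>x. unit_obj T \<odot>\<^bsub>T\<^esub> x), farr = (\<lambda>f. \<one> (unit_obj T) \<otimes>\<^bsub>T\<^esub> f)\<rparr>
      id_functor (lunit T)"
    and runit_iso: "nat_iso C C
      \<lparr>fobj = (\<lambda>x. x \<odot>\<^bsub>T\<^esub> unit_obj T), farr = (\<lambda>f. f \<otimes>\<^bsub>T\<^esub> \<one> (unit_obj T))\<rparr>
      id_functor (runit T)"
    and pentagon: "w \<in> Obj C \<Longrightarrow> x \<in> Obj C \<Longrightarrow> y \<in> Obj C \<Longrightarrow> z \<in> Obj C \<Longrightarrow>
      (\<one> w \<otimes>\<^bsub>T\<^esub> assoc T (x, y, z)) \<cdot> assoc T (w, x \<odot>\<^bsub>T\<^esub> y, z) \<cdot> (assoc T (w, x, y) \<otimes>\<^bsub>T\<^esub> \<one> z)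
        = assoc T (w, x, y \<odot>\<^bsub>T\<^esub> z) \<cdot> assoc T (w \<odot>\<^bsub>T\<^esub> x, y, z)"
    and triangle: "x \<in> Obj C \<Longrightarrow> y \<in> Obj C \<Longrightarrow>
      (\<one> x \<otimes>\<^bsub>T\<^esub> lunit T y) \<cdot> assoc T (x, unit_obj T, y) = runit T x \<otimes>\<^bsub>T\<^esub> \<one> y"

locale braided_monoidal_category = monoidal_category C T
  for C :: "('o, 'm) cat" (structure) and T :: "('o, 'm) monoidal_structure" +
  fixes \<beta> :: "'o \<times> 'o \<Rightarrow> 'm"
  assumes braiding_iso: "nat_iso (C \<times>\<^sub>c C) C (tensor T)
      \<lparr>fobj = (\<lambda>(x, y). y \<odot>\<^bsub>T\<^esub> x), farr = (\<lambda>(f, g). g \<otimes>\<^bsub>T\<^esub> f)\<rparr> \<beta>"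
    and hexagon: "x \<in> Obj C \<Longrightarrow> y \<in> Obj C \<Longrightarrow> z \<in> Obj C \<Longrightarrow>
      assoc T (y, z, x) \<cdot> \<beta> (x, y \<odot>\<^bsub>T\<^esub> z) \<cdot> assoc T (x, y, z)
        = (\<one> y \<otimes>\<^bsub>T\<^esub> \<beta> (x, z)) \<cdot> assoc T (y, x, z) \<cdot> (\<beta> (x, y) \<otimes>\<^bsub>T\<^esub> \<one> z)"
    and hexagon': "x \<in> Obj C \<Longrightarrow> y \<in> Obj C \<Longrightarrow> z \<in> Obj C \<Longrightarrow>
      inv_arr C (assoc T (z, x, y)) \<cdot> \<beta> (x \<odot>\<^bsub>T\<^esub> y, z) \<cdot> inv_arr C (assoc T (x, y, z))
        = (\<beta> (x, z) \<otimes>\<^bsub>T\<^esub> \<one> y) \<cdot> inv_arr C (assoc T (x, z, y)) \<cdot> (\<one> x \<otimes>\<^bsub>T\<^esub> \<beta> (y, z))"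

locale symmetric_monoidal_category = braided_monoidal_category C T \<beta>
  for C :: "('o, 'm) cat" (structure) and T :: "('o, 'm) monoidal_structure"
    and \<beta> :: "'o \<times> 'o \<Rightarrow> 'm" +
  assumes symmetry: "x \<in> Obj C \<Longrightarrow> y \<in> Obj C \<Longrightarrow> \<beta> (y, x) \<cdot> \<beta> (x, y) = \<one> (x \<odot>\<^bsub>T\<^esub> y)"


section \<open>Oplax monoidal functors\<close>

locale oplax_monoidal_functor =
  C: monoidal_category C S + D: monoidal_category D T + cat_functor C D F
  for C :: "('o, 'm) cat" and S :: "('o, 'm) monoidal_structure"
    and D :: "('p, 'n) cat" and T :: "('p, 'n) monoidal_structure"
    and F :: "('o, 'm, 'p, 'n) ftor" +
  fixes \<phi>\<^sub>0 :: 'n and \<phi> :: "'o \<times> 'o \<Rightarrow> 'n"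
  assumes counit_in: "\<phi>\<^sub>0 \<in> hom D (fobj F (unit_obj S)) (unit_obj T)"
    and comult_natural: "nat_trans (C \<times>\<^sub>c C) D
      \<lparr>fobj = (\<lambda>(x, y). fobj F (x \<odot>\<^bsub>S\<^esub> y)), farr = (\<lambda>(f, g). farr F (f \<otimes>\<^bsub>S\<^esub> g))\<rparr>
      \<lparr>fobj = (\<lambda>(x, y). fobj F x \<odot>\<^bsub>T\<^esub> fobj F y), farr = (\<lambda>(f, g). farr F f \<otimes>\<^bsub>T\<^esub> farr F g)\<rparr>
      \<phi>"
    and oplax_lunit: "x \<in> Obj C \<Longrightarrow>
      lunit T (fobj F x) \<cdot>\<^bsub>D\<^esub> (\<phi>\<^sub>0 \<otimes>\<^bsub>T\<^esub> \<one>\<^bsub>D\<^esub> (fobj F x)) \<cdot>\<^bsub>D\<^esub> \<phi> (unit_obj S, x)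
        = farr F (lunit S x)"
    and oplax_runit: "x \<in> Obj C \<Longrightarrow>
      runit T (fobj F x) \<cdot>\<^bsub>D\<^esub> (\<one>\<^bsub>D\<^esub> (fobj F x) \<otimes>\<^bsub>T\<^esub> \<phi>\<^sub>0) \<cdot>\<^bsub>D\<^esub> \<phi> (x, unit_obj S)
        = farr F (runit S x)"
    and oplax_assoc: "x \<in> Obj C \<Longrightarrow> y \<in> Obj C \<Longrightarrow> z \<in> Obj C \<Longrightarrow>
      (\<one>\<^bsub>D\<^esub> (fobj F x) \<otimes>\<^bsub>T\<^esub> \<phi> (y, z)) \<cdot>\<^bsub>D\<^esub> \<phi> (x, y \<odot>\<^bsub>S\<^esub> z) \<cdot>\<^bsub>D\<^esub> farr F (assoc S (x, y, z))
        = assoc T (fobj F x, fobj F y, fobj F z)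
            \<cdot>\<^bsub>D\<^esub> (\<phi> (x, y) \<otimes>\<^bsub>T\<^esub> \<one>\<^bsub>D\<^esub> (fobj F z)) \<cdot>\<^bsub>D\<^esub> \<phi> (x \<odot>\<^bsub>S\<^esub> y, z)"

locale oplax_braided_monoidal_functor =
  C: braided_monoidal_category C S \<beta> + D: braided_monoidal_category D T \<gamma> +
  oplax_monoidal_functor C S D T F \<phi>\<^sub>0 \<phi>
  for C :: "('o, 'm) cat" and S :: "('o, 'm) monoidal_structure" and \<beta> :: "'o \<times> 'o \<Rightarrow> 'm"
    and D :: "('p, 'n) cat" and T :: "('p, 'n) monoidal_structure" and \<gamma> :: "'p \<times> 'p \<Rightarrow> 'n"
    and F :: "('o, 'm, 'p, 'n) ftor" and \<phi>\<^sub>0 :: 'n and \<phi> :: "'o \<times> 'o \<Rightarrow> 'n" +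
  assumes oplax_braiding: "x \<in> Obj C \<Longrightarrow> y \<in> Obj C \<Longrightarrow>
      \<gamma> (fobj F x, fobj F y) \<cdot>\<^bsub>D\<^esub> \<phi> (x, y) = \<phi> (y, x) \<cdot>\<^bsub>D\<^esub> farr F (\<beta> (x, y))"

locale oplax_symmetric_monoidal_functor =
  C: symmetric_monoidal_category C S \<beta> + D: symmetric_monoidal_category D T \<gamma> +
  oplax_braided_monoidal_functor C S \<beta> D T \<gamma> F \<phi>\<^sub>0 \<phi>
  for C :: "('o, 'm) cat" and S :: "('o, 'm) monoidal_structure" and \<beta> :: "'o \<times> 'o \<Rightarrow> 'm"
    and D :: "('p, 'n) cat" and T :: "('p, 'n) monoidal_structure" and \<gamma> :: "'p \<times> 'p \<Rightarrow> 'n"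
    and F :: "('o, 'm, 'p, 'n) ftor" and \<phi>\<^sub>0 :: 'n and \<phi> :: "'o \<times> 'o \<Rightarrow> 'n"


section \<open>Orthogonal factorisation systems\<close>

definition orthogonal :: "('o, 'm) cat \<Rightarrow> 'm \<Rightarrow> 'm \<Rightarrow> bool" where
  "orthogonal C e m \<longleftrightarrow>
    (\<forall>u \<in> hom C (Dom C e) (Dom C m). \<forall>v \<in> hom C (Cod C e) (Cod C m).
      m \<cdot>\<^bsub>C\<^esub> u = v \<cdot>\<^bsub>C\<^esub> e \<longrightarrow>
      (\<exists>!d. d \<in> hom C (Cod C e) (Dom C m) \<and> d \<cdot>\<^bsub>C\<^esub> e = u \<and> m \<cdot>\<^bsub>C\<^esub> d = v))"

locale orthogonal_factorisation_system = category C
  for C :: "('o, 'm) cat" (structure) +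
  fixes \<E> \<M> :: "'m set"
  assumes factorisation: "f \<in> hom C x y \<Longrightarrow>
      \<exists>z e m. e \<in> \<E> \<and> m \<in> \<M> \<and> e \<in> hom C x z \<and> m \<in> hom C z y \<and> f = m \<cdot> e"
    and left_class: "\<E> = {f \<in> Arr C. \<forall>m \<in> \<M>. orthogonal C f m}"
    and right_class: "\<M> = {g \<in> Arr C. \<forall>e \<in> \<E>. orthogonal C e g}"



section \<open>Structures lying between two monoidal structures\<close>

text \<open>
  \<open>P\<close> is a tensor functor with the prescribed object map \<open>X\<close> for which the given components form
  natural transformations \<open>tensor T\<^sub>1 \<Rightarrow> P \<Rightarrow> tensor T\<^sub>2\<close>. When the \<open>e (x, y)\<close> are in \<open>\<E>\<close> and the
  \<open>m (x, y)\<close> in \<open>\<M>\<close>, the two naturality squares force \<open>P\<close> to act on arrows by diagonal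
  fillers.
\<close>

definition intermediate_tensor ::
  "('o, 'm) cat \<Rightarrow> ('o, 'm) monoidal_structure \<Rightarrow> ('o, 'm) monoidal_structure \<Rightarrow>
    ('o \<times> 'o \<Rightarrow> 'o) \<Rightarrow> ('o \<times> 'o \<Rightarrow> 'm) \<Rightarrow> ('o \<times> 'o \<Rightarrow> 'm) \<Rightarrow>
    ('o \<times> 'o, 'm \<times> 'm, 'o, 'm) ftor \<Rightarrow> bool" where
  "intermediate_tensor C T\<^sub>1 T\<^sub>2 X e m P \<longleftrightarrow>
    cat_functor (C \<times>\<^sub>c C) C P \<and>
    (\<forall>x \<in> Obj C. \<forall>y \<in> Obj C. fobj P (x, y) = X (x, y)) \<and>
    nat_trans (C \<times>\<^sub>c C) C (tensor T\<^sub>1) P e \<and>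
    nat_trans (C \<times>\<^sub>c C) C P (tensor T\<^sub>2) m"

definition intermediate_monoidal ::
  "('o, 'm) cat \<Rightarrow> ('o, 'm) monoidal_structure \<Rightarrow> ('o, 'm) monoidal_structure \<Rightarrow>
    'm \<Rightarrow> ('o \<times> 'o \<Rightarrow> 'm) \<Rightarrow> 'm \<Rightarrow> ('o \<times> 'o \<Rightarrow> 'm) \<Rightarrow>
    ('o, 'm) monoidal_structure \<Rightarrow> bool" where
  "intermediate_monoidal C T\<^sub>1 T\<^sub>2 e\<^sub>0 e m\<^sub>0 m T \<longleftrightarrow>
    monoidal_category C T \<and>
    oplax_monoidal_functor C T\<^sub>1 C T id_functor e\<^sub>0 e \<and>
    oplax_monoidal_functor C T C T\<^sub>2 id_functor m\<^sub>0 m"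

end

theory Submission
  imports Defs
begin

text \<open>
  Factorisations \<open>A \<rightarrow> Z \<rightarrow> B\<close> into an \<open>\<E>\<close>-map and an \<open>\<M>\<close>-map are the objects of a category whose
  morphisms are triples \<open>(u, w, v)\<close> making both squares commute. Orthogonality says that \<open>w\<close> exists and
  is unique once the outer square given by \<open>u\<close> and \<open>v\<close> commutes. The closure assumptions on \<open>\<E>\<close> and
  \<open>\<M>\<close> let factorisations be tensored, using \<open>\<otimes>\<^sub>1\<close> on \<open>A\<close>, \<open>\<otimes>\<close> on \<open>Z\<close> and \<open>\<otimes>\<^sub>2\<close> on \<open>B\<close>.
  Each constraint of \<open>\<otimes>\<close> is the middle component of a morphism whose outer components are the
  corresponding constraints of \<open>\<otimes>\<^sub>1\<close> and \<open>\<otimes>\<^sub>2\<close>, the outer square being an oplax axiom for \<open>f\<close>. The two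
  squares of this morphism are the oplax axioms for \<open>e\<close> and \<open>m\<close>. Naturality, invertibility and
  coherence of the middle components follow from those of the outer ones by uniqueness.
\<close>

section \<open>Categories and bifunctors\<close>

text \<open>A coherence law evaluates constraints at tensor products. The pentagon contains the
  associator at \<open>w\<close>, \<open>x \<otimes> y\<close>, \<open>z\<close>, and the outer
  structures have \<open>x \<otimes>\<^sub>1 y\<close> and \<open>x \<otimes>\<^sub>2 y\<close> in
  that middle position. These are three different objects, so a constraint known only as a filler
  over single objects cannot be used there. The remedy is to let constraints take arbitrary
  factorisations as arguments, here the factorisation of \<open>f (x, y)\<close> itself. Passing
  from objects to factorisations uses naturality of the new constraints, which therefore comes
  before every coherence law and is obtained from fillers over objects alone. The tensor product of
  factorisations rests on the two readings of a naturality square of \<open>e\<close>. With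
  \<open>e\<close> applied last, its diagonal is a composite of \<E>-maps, by closure of \<E> under
  \<open>\<otimes>\<^sub>1\<close>. With \<open>e\<close> applied first, it is the expression
  occurring in the oplax axioms. For \<open>m\<close>, the reading with \<open>m\<close> applied
  first does both jobs.\<close>

lemma hom_iff: "f \<in> hom C x y \<longleftrightarrow> f \<in> Arr C \<and> Dom C f = x \<and> Cod C f = y"
  by (simp add: hom_def)

context category
begin

lemma Dom_Cod_Obj [simp]:
  "f \<in> Arr C \<Longrightarrow> Dom C f \<in> Obj C" "f \<in> Arr C \<Longrightarrow> Cod C f \<in> Obj C"
  by (rule Dom_in Cod_in, assumption)+

lemma Ident_simps [simp]:
  assumes "x \<in> Obj C"
  shows "\<one> x \<in> Arr C" "Dom C (\<one> x) = x" "Cod C (\<one> x) = x"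
  using Ident_in[OF assms] by (simp_all add: hom_iff)

lemma Comp_simps [simp]:
  assumes "f \<in> Arr C" "g \<in> Arr C" "Dom C g = Cod C f"
  shows "g \<cdot> f \<in> Arr C" "Dom C (g \<cdot> f) = Dom C f" "Cod C (g \<cdot> f) = Cod C g"
  using Comp_in[of f "Dom C f" "Cod C f" g "Cod C g"] assms by (simp_all add: hom_iff)

lemma Comp_Ident_simps [simp]:
  "f \<in> Arr C \<Longrightarrow> Dom C f = x \<Longrightarrow> f \<cdot> \<one> x = f"
  "f \<in> Arr C \<Longrightarrow> Cod C f = x \<Longrightarrow> \<one> x \<cdot> f = f"
  using Comp_Ident Ident_Comp by (auto simp: hom_iff)

lemma Comp_assoc_simp [simp]:
  assumes "f \<in> Arr C" "g \<in> Arr C" "h \<in> Arr C" "Dom C g = Cod C f" "Dom C h = Cod C g"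
  shows "(h \<cdot> g) \<cdot> f = h \<cdot> (g \<cdot> f)"
  using Comp_assoc[of f "Dom C f" "Cod C f" g "Cod C g" h "Cod C h"] assms
  by (simp add: hom_iff)

text \<open>Composites are normalised to right-nested form, where the two sides of a commuting
  square are no subterms once an arrow \<open>k\<close> precedes them. Here the square is rewritten
  together with \<open>k\<close>.\<close>

lemma Comp_reassoc:
  assumes "g \<cdot> f = g' \<cdot> f'"
    and "k \<in> Arr C" "f \<in> Arr C" "g \<in> Arr C" "f' \<in> Arr C" "g' \<in> Arr C"
    and "Dom C f = Cod C k" "Dom C g = Cod C f" "Dom C f' = Cod C k" "Dom C g' = Cod C f'"
  shows "g \<cdot> f \<cdot> k = g' \<cdot> f' \<cdot> k"
  using assms Comp_assoc_simp by metis

lemma inverse_arrows_unique: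
  assumes "inverse_arrows C f g" "inverse_arrows C f h"
  shows "g = h"
proof -
  note [simp] = assms[unfolded inverse_arrows_def hom_iff]
  have "(h \<cdot> f) \<cdot> g = h \<cdot> (f \<cdot> g)" by (rule Comp_assoc_simp) simp_all
  then show ?thesis by simp
qed

text \<open>Insert \<open>u \<cdot> u'\<close>, move \<open>g\<close> across the square and cancel
  \<open>v' \<cdot> v\<close>. It supplies the outer square when a morphism of factorisations is
  inverted.\<close>

lemma inverse_arrows_square:
  assumes "v \<cdot> f = g \<cdot> u" and f: "f \<in> Arr C" "Dom C f = Dom C u" "Cod C f = Dom C v"
    and g: "g \<in> Arr C" "Dom C g = Cod C u" "Cod C g = Cod C v"
    and u': "inverse_arrows C u u'" and v': "inverse_arrows C v v'"
  shows "v' \<cdot> g = f \<cdot> u'"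
proof -
  have [simp]: "u \<in> Arr C" "u' \<in> Arr C" "Dom C u' = Cod C u" "Cod C u' = Dom C u"
    "v \<in> Arr C" "v' \<in> Arr C" "Dom C v' = Cod C v" "Cod C v' = Dom C v"
    and uv: "u \<cdot> u' = \<one> (Cod C u)" "v' \<cdot> v = \<one> (Dom C v)"
    using u' v' by (simp_all add: inverse_arrows_def hom_iff)
  note [simp] = f g
  have "v' \<cdot> g = v' \<cdot> g \<cdot> u \<cdot> u'" by (simp add: uv)
  also have "g \<cdot> u \<cdot> u' = v \<cdot> f \<cdot> u'"
    by (rule Comp_reassoc[OF assms(1)[symmetric]]) simp_all
  also have "v' \<cdot> v \<cdot> f \<cdot> u' = (v' \<cdot> v) \<cdot> f \<cdot> u'" by simp
  also have "\<dots> = f \<cdot> u'" by (simp add: uv del: Comp_assoc_simp)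
  finally show ?thesis .
qed

lemma inv_arr_eq: "inverse_arrows C f g \<Longrightarrow> inv_arr C f = g"
  unfolding inv_arr_def using inverse_arrows_unique by blast

lemma inverse_arrows_inv_arr: "iso C f \<Longrightarrow> inverse_arrows C f (inv_arr C f)"
  using inv_arr_eq by (auto simp: iso_def)

end

section \<open>Product categories and functors of several variables\<close>

lemma category_prod_cat:
  assumes "category C" "category D"
  shows "category (C \<times>\<^sub>c D)"
proof -
  interpret C: category C by fact
  interpret D: category D by fact
  show ?thesis
    by unfold_locales (auto simp: prod_cat_def hom_iff)
qed

locale bifunctor = category C
  for C :: "('o, 'm) cat" (structure) +
  fixes P :: "('o \<times> 'o, 'm \<times> 'm, 'o, 'm) ftor"
  assumes bifunctor: "cat_functor (C \<times>\<^sub>c C) C P"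
begin

lemma fobj_Obj [simp]: "x \<in> Obj C \<Longrightarrow> y \<in> Obj C \<Longrightarrow> fobj P (x, y) \<in> Obj C"
  using cat_functor.fobj_in[OF bifunctor, of "(x, y)"] by (simp add: prod_cat_def)

lemma farr_simps [simp]:
  assumes "p \<in> Arr C" "q \<in> Arr C"
  shows "farr P (p, q) \<in> Arr C"
    "Dom C (farr P (p, q)) = fobj P (Dom C p, Dom C q)"
    "Cod C (farr P (p, q)) = fobj P (Cod C p, Cod C q)"
  using cat_functor.farr_in[OF bifunctor, of "(p, q)" "(Dom C p, Dom C q)" "(Cod C p, Cod C q)"]
    assms by (simp_all add: prod_cat_def hom_iff)

lemma farr_Ident [simp]:
  "x \<in> Obj C \<Longrightarrow> y \<in> Obj C \<Longrightarrow> farr P (\<one> x, \<one> y) = \<one> (fobj P (x, y))"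
  using cat_functor.farr_Ident[OF bifunctor, of "(x, y)"] by (simp add: prod_cat_def)

lemma farr_Comp:
  assumes "p \<in> Arr C" "q \<in> Arr C" "p' \<in> Arr C" "q' \<in> Arr C" "Dom C p' = Cod C p" "Dom C q' = Cod C q"
  shows "farr P (p' \<cdot> p, q' \<cdot> q) = farr P (p', q') \<cdot> farr P (p, q)"
  using cat_functor.farr_Comp[OF bifunctor, of "(p, q)" "(Dom C p, Dom C q)" "(Cod C p, Cod C q)"
      "(p', q')" "(Cod C p', Cod C q')"] assms by (simp add: prod_cat_def hom_iff)

text \<open>A natural isomorphism presupposes that its source and target are functors. This lemma
  and the next four provide them for the associator, the braiding and the two unit
  constraints.\<close>

lemma left_triple_functor:
  "cat_functor (C \<times>\<^sub>c C \<times>\<^sub>c C) C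
    \<lparr>fobj = (\<lambda>(x, y, z). fobj P (fobj P (x, y), z)),
     farr = (\<lambda>(f, g, h). farr P (farr P (f, g), h))\<rparr>"
proof -
  interpret category "C \<times>\<^sub>c C \<times>\<^sub>c C" by (intro category_prod_cat category_axioms)
  show ?thesis
    by unfold_locales (auto simp: prod_cat_def hom_iff farr_Comp)
qed

lemma right_triple_functor:
  "cat_functor (C \<times>\<^sub>c C \<times>\<^sub>c C) C
    \<lparr>fobj = (\<lambda>(x, y, z). fobj P (x, fobj P (y, z))),
     farr = (\<lambda>(f, g, h). farr P (f, farr P (g, h)))\<rparr>"
proof -
  interpret category "C \<times>\<^sub>c C \<times>\<^sub>c C" by (intro category_prod_cat category_axioms)
  show ?thesis
    by unfold_locales (auto simp: prod_cat_def hom_iff farr_Comp)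
qed

lemma swapped_functor:
  "cat_functor (C \<times>\<^sub>c C) C
    \<lparr>fobj = (\<lambda>(x, y). fobj P (y, x)), farr = (\<lambda>(f, g). farr P (g, f))\<rparr>"
proof -
  interpret category "C \<times>\<^sub>c C" by (intro category_prod_cat category_axioms)
  show ?thesis
    by unfold_locales (auto simp: prod_cat_def hom_iff farr_Comp)
qed

lemma left_unit_functor:
  assumes "i \<in> Obj C"
  shows "cat_functor C C \<lparr>fobj = (\<lambda>x. fobj P (i, x)), farr = (\<lambda>f. farr P (\<one> i, f))\<rparr>"
  using assms farr_Comp[of "\<one> i" _ "\<one> i"] by unfold_locales (auto simp: hom_iff)

lemma right_unit_functor:
  assumes "i \<in> Obj C"
  shows "cat_functor C C \<lparr>fobj = (\<lambda>x. fobj P (x, i)), farr = (\<lambda>f. farr P (f, \<one> i))\<rparr>"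
  using assms farr_Comp[of _ "\<one> i" _ "\<one> i"] by unfold_locales (auto simp: hom_iff)

end

lemma (in category) id_functor: "cat_functor C C id_functor"
  by unfold_locales (auto simp: id_functor_def)

text \<open>
  A natural transformation \<open>\<phi>\<close> between tensor functors extends from objects to arrows as the diagonal
  of its naturality squares; the oplax axioms then say that the constraints of source and target
  are compatible with this diagonal.
\<close>

locale tensor_comparison = P: bifunctor C P + Q: bifunctor C Q
  for C :: "('o, 'm) cat" (structure) and P Q :: "('o \<times> 'o, 'm \<times> 'm, 'o, 'm) ftor" +
  fixes \<phi> :: "'o \<times> 'o \<Rightarrow> 'm"
  assumes comparison: "nat_trans (C \<times>\<^sub>c C) C P Q \<phi>"
begin

definition diagonal :: "'m \<Rightarrow> 'm \<Rightarrow> 'm" where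
  "diagonal p q = farr Q (p, q) \<cdot> \<phi> (Dom C p, Dom C q)"

lemma component_simps [simp]:
  assumes "x \<in> Obj C" "y \<in> Obj C"
  shows "\<phi> (x, y) \<in> Arr C" "Dom C (\<phi> (x, y)) = fobj P (x, y)" "Cod C (\<phi> (x, y)) = fobj Q (x, y)"
  using nat_trans.component_in[OF comparison, of "(x, y)"] assms
  by (simp_all add: prod_cat_def hom_iff)

lemma component_natural:
  assumes "p \<in> Arr C" "q \<in> Arr C"
  shows "\<phi> (Cod C p, Cod C q) \<cdot> farr P (p, q) = farr Q (p, q) \<cdot> \<phi> (Dom C p, Dom C q)"
  using nat_trans.naturality[OF comparison, of "(p, q)" "(Dom C p, Dom C q)" "(Cod C p, Cod C q)"]
    assms by (simp add: prod_cat_def hom_iff)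

lemma diagonal_simps [simp]:
  assumes "p \<in> Arr C" "q \<in> Arr C"
  shows "diagonal p q \<in> Arr C"
    "Dom C (diagonal p q) = fobj P (Dom C p, Dom C q)"
    "Cod C (diagonal p q) = fobj Q (Cod C p, Cod C q)"
  using assms by (simp_all add: diagonal_def)

lemma diagonal_Ident: "x \<in> Obj C \<Longrightarrow> y \<in> Obj C \<Longrightarrow> diagonal (\<one> x) (\<one> y) = \<phi> (x, y)"
  by (simp add: diagonal_def)

text \<open>The other way round the naturality square. The definition has the shape of the oplax
  axioms; this form shows that the diagonal for \<open>e\<close> lies in \<E>.\<close>

lemma diagonal_eq:
  "p \<in> Arr C \<Longrightarrow> q \<in> Arr C \<Longrightarrow> diagonal p q = \<phi> (Cod C p, Cod C q) \<cdot> farr P (p, q)"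
  by (simp add: diagonal_def component_natural)

text \<open>Together with \<open>diagonal_precomp\<close> this makes diagonals a two-sided action:
  arrows tensored in the target act after them, arrows tensored in the source before them.\<close>

lemma diagonal_postcomp:
  assumes "p \<in> Arr C" "q \<in> Arr C" "g \<in> Arr C" "h \<in> Arr C" "Dom C g = Cod C p" "Dom C h = Cod C q"
  shows "diagonal (g \<cdot> p) (h \<cdot> q) = farr Q (g, h) \<cdot> diagonal p q"
  using assms by (simp add: diagonal_def Q.farr_Comp)

lemma diagonal_precomp:
  assumes "p \<in> Arr C" "q \<in> Arr C" "g \<in> Arr C" "h \<in> Arr C" "Dom C p = Cod C g" "Dom C q = Cod C h"
  shows "diagonal (p \<cdot> g) (q \<cdot> h) = diagonal p q \<cdot> farr P (g, h)"
  using assms by (simp add: diagonal_eq P.farr_Comp)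

text \<open>At identities, \<open>coh\<close> is the oplax associativity axiom. Every iterated
  diagonal is the one at identities followed by arrows tensored in the target, and naturality of
  \<open>aT\<close> carries the axiom past these arrows.\<close>

lemma diagonal_assoc:
  assumes aS: "\<And>x y z. x \<in> Obj C \<Longrightarrow> y \<in> Obj C \<Longrightarrow> z \<in> Obj C \<Longrightarrow>
      aS (x, y, z) \<in> hom C (fobj P (fobj P (x, y), z)) (fobj P (x, fobj P (y, z)))"
    and aT: "nat_trans (C \<times>\<^sub>c C \<times>\<^sub>c C) C
      \<lparr>fobj = (\<lambda>(x, y, z). fobj Q (fobj Q (x, y), z)),
       farr = (\<lambda>(f, g, h). farr Q (farr Q (f, g), h))\<rparr>
      \<lparr>fobj = (\<lambda>(x, y, z). fobj Q (x, fobj Q (y, z))),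
       farr = (\<lambda>(f, g, h). farr Q (f, farr Q (g, h)))\<rparr> aT"
    and coh: "\<And>x y z. x \<in> Obj C \<Longrightarrow> y \<in> Obj C \<Longrightarrow> z \<in> Obj C \<Longrightarrow>
      aT (x, y, z) \<cdot> diagonal (diagonal (\<one> x) (\<one> y)) (\<one> z)
        = diagonal (\<one> x) (diagonal (\<one> y) (\<one> z)) \<cdot> aS (x, y, z)"
    and arrs: "p \<in> Arr C" "q \<in> Arr C" "r \<in> Arr C"
  shows "aT (Cod C p, Cod C q, Cod C r) \<cdot> diagonal (diagonal p q) r
    = diagonal p (diagonal q r) \<cdot> aS (Dom C p, Dom C q, Dom C r)"
proof -
  let ?D = "(Dom C p, Dom C q, Dom C r)" and ?C = "(Cod C p, Cod C q, Cod C r)"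
  have D: "?D \<in> Obj (C \<times>\<^sub>c C \<times>\<^sub>c C)" and C: "?C \<in> Obj (C \<times>\<^sub>c C \<times>\<^sub>c C)"
    and h: "(p, q, r) \<in> hom (C \<times>\<^sub>c C \<times>\<^sub>c C) ?D ?C"
    using arrs by (simp_all add: prod_cat_def hom_iff)
  note [simp] = nat_trans.component_in[OF aT D, simplified hom_iff, simplified]
    nat_trans.component_in[OF aT C, simplified hom_iff, simplified]
  have [simp]: "aS ?D \<in> Arr C"
    "Dom C (aS ?D) = fobj P (fobj P (Dom C p, Dom C q), Dom C r)"
    "Cod C (aS ?D) = fobj P (Dom C p, fobj P (Dom C q, Dom C r))"
    using aS arrs by (simp_all add: hom_iff)
  \<comment> \<open>Each arrow is read as itself after the identity of its domain, so that two uses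
    of \<open>diagonal_postcomp\<close> pull all the arrows out to the left.\<close>
  have l: "diagonal (diagonal p q) r
      = farr Q (farr Q (p, q), r) \<cdot> diagonal (diagonal (\<one> (Dom C p)) (\<one> (Dom C q))) (\<one> (Dom C r))"
    using arrs diagonal_postcomp[of "\<one> (Dom C p)" "\<one> (Dom C q)" p q]
      diagonal_postcomp[of "diagonal (\<one> (Dom C p)) (\<one> (Dom C q))" "\<one> (Dom C r)" "farr Q (p, q)" r]
    by simp
  have r: "diagonal p (diagonal q r)
      = farr Q (p, farr Q (q, r)) \<cdot> diagonal (\<one> (Dom C p)) (diagonal (\<one> (Dom C q)) (\<one> (Dom C r)))"
    using arrs diagonal_postcomp[of "\<one> (Dom C q)" "\<one> (Dom C r)" q r]
      diagonal_postcomp[of "\<one> (Dom C p)" "diagonal (\<one> (Dom C q)) (\<one> (Dom C r))" p "farr Q (q, r)"]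
    by simp
  have n: "aT ?C \<cdot> farr Q (farr Q (p, q), r) = farr Q (p, farr Q (q, r)) \<cdot> aT ?D"
    using nat_trans.naturality[OF aT h] by simp
  have "aT ?C \<cdot> diagonal (diagonal p q) r = (aT ?C \<cdot> farr Q (farr Q (p, q), r))
      \<cdot> diagonal (diagonal (\<one> (Dom C p)) (\<one> (Dom C q))) (\<one> (Dom C r))"
    using arrs by (simp add: l)
  also have "\<dots> = farr Q (p, farr Q (q, r)) \<cdot>
      (aT ?D \<cdot> diagonal (diagonal (\<one> (Dom C p)) (\<one> (Dom C q))) (\<one> (Dom C r)))"
    using arrs by (simp add: n)
  also have "\<dots> = diagonal p (diagonal q r) \<cdot> aS ?D"
    using arrs by (simp add: r coh)
  finally show ?thesis .
qed

text \<open>The reduction to identities used for associators, with naturality of \<open>bT\<close>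
  exchanging the two arrows.\<close>

lemma diagonal_braiding:
  assumes bS: "\<And>x y. x \<in> Obj C \<Longrightarrow> y \<in> Obj C \<Longrightarrow> bS (x, y) \<in> hom C (fobj P (x, y)) (fobj P (y, x))"
    and bT: "nat_trans (C \<times>\<^sub>c C) C Q
      \<lparr>fobj = (\<lambda>(x, y). fobj Q (y, x)), farr = (\<lambda>(f, g). farr Q (g, f))\<rparr> bT"
    and coh: "\<And>x y. x \<in> Obj C \<Longrightarrow> y \<in> Obj C \<Longrightarrow>
      bT (x, y) \<cdot> diagonal (\<one> x) (\<one> y) = diagonal (\<one> y) (\<one> x) \<cdot> bS (x, y)"
    and arrs: "p \<in> Arr C" "q \<in> Arr C"
  shows "bT (Cod C p, Cod C q) \<cdot> diagonal p q = diagonal q p \<cdot> bS (Dom C p, Dom C q)"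
proof -
  let ?D = "(Dom C p, Dom C q)" and ?C = "(Cod C p, Cod C q)"
  have D: "?D \<in> Obj (C \<times>\<^sub>c C)" and C: "?C \<in> Obj (C \<times>\<^sub>c C)" and h: "(p, q) \<in> hom (C \<times>\<^sub>c C) ?D ?C"
    using arrs by (simp_all add: prod_cat_def hom_iff)
  note [simp] = nat_trans.component_in[OF bT D, simplified hom_iff, simplified]
    nat_trans.component_in[OF bT C, simplified hom_iff, simplified]
  have [simp]: "bS ?D \<in> Arr C" "Dom C (bS ?D) = fobj P (Dom C p, Dom C q)"
    "Cod C (bS ?D) = fobj P (Dom C q, Dom C p)"
    using bS arrs by (simp_all add: hom_iff)
  have "diagonal p q = farr Q (p, q) \<cdot> diagonal (\<one> (Dom C p)) (\<one> (Dom C q))"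
    using arrs diagonal_postcomp[of "\<one> (Dom C p)" "\<one> (Dom C q)" p q] by simp
  then have "bT ?C \<cdot> diagonal p q
      = (bT ?C \<cdot> farr Q (p, q)) \<cdot> diagonal (\<one> (Dom C p)) (\<one> (Dom C q))"
    using arrs by simp
  also have "\<dots> = farr Q (q, p) \<cdot> (bT ?D \<cdot> diagonal (\<one> (Dom C p)) (\<one> (Dom C q)))"
    using arrs nat_trans.naturality[OF bT h] by simp
  also have "\<dots> = (farr Q (q, p) \<cdot> diagonal (\<one> (Dom C q)) (\<one> (Dom C p))) \<cdot> bS ?D"
    using arrs by (simp add: coh)
  also have "\<dots> = diagonal q p \<cdot> bS ?D"
    using arrs diagonal_postcomp[of "\<one> (Dom C q)" "\<one> (Dom C p)" q p] by simp
  finally show ?thesis .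
qed

end

section \<open>Morphisms of factorisations\<close>

context orthogonal_factorisation_system
begin

section \<open>Diagonal fillers, and closure of both classes under identities and
  composition\<close>

lemma left_class_arr [simp]: "g \<in> \<E> \<Longrightarrow> g \<in> Arr C"
  using left_class by blast

lemma right_class_arr [simp]: "g \<in> \<M> \<Longrightarrow> g \<in> Arr C"
  using right_class by blast

lemma filler:
  assumes "p \<in> \<E>" "q \<in> \<M>" "u \<in> hom C (Dom C p) (Dom C q)" "v \<in> hom C (Cod C p) (Cod C q)"
    and "q \<cdot> u = v \<cdot> p"
  shows "\<exists>!d. d \<in> hom C (Cod C p) (Dom C q) \<and> d \<cdot> p = u \<and> q \<cdot> d = v"
proof -
  have "orthogonal C p q" using assms(1,2) left_class by blast
  then show ?thesis using assms unfolding orthogonal_def by blast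
qed

text \<open>Both arrows fill the square with sides \<open>d \<cdot> p\<close> and
  \<open>q \<cdot> d\<close>. Thus an arrow between an \<E>-map and an \<M>-map can be tested by
  composing on both ends.\<close>

lemma filler_unique:
  assumes "p \<in> \<E>" "q \<in> \<M>" "d \<in> Arr C" "d' \<in> Arr C"
    and "Dom C d = Cod C p" "Dom C d' = Cod C p" "Cod C d = Dom C q" "Cod C d' = Dom C q"
    and "d \<cdot> p = d' \<cdot> p" "q \<cdot> d = q \<cdot> d'"
  shows "d = d'"
proof -
  have "\<exists>!k. k \<in> hom C (Cod C p) (Dom C q) \<and> k \<cdot> p = d \<cdot> p \<and> q \<cdot> k = q \<cdot> d"
    using assms(1-8) by (intro filler) (simp_all add: hom_iff)
  moreover have "d \<in> hom C (Cod C p) (Dom C q)" "d' \<in> hom C (Cod C p) (Dom C q)"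
    using assms by (simp_all add: hom_iff)
  ultimately show ?thesis using assms(9,10) by metis
qed

text \<open>Against an identity the filler must be \<open>u\<close> itself. This and the dual fact,
  where the filler is \<open>v\<close>, make an object into a factorisation of its identity.\<close>

lemma left_class_Ident [simp]:
  assumes x: "x \<in> Obj C"
  shows "\<one> x \<in> \<E>"
proof -
  have "orthogonal C (\<one> x) q" if q: "q \<in> \<M>" for q
    unfolding orthogonal_def
  proof (intro ballI impI)
    fix u v
    assume "u \<in> hom C (Dom C (\<one> x)) (Dom C q)" "v \<in> hom C (Cod C (\<one> x)) (Cod C q)" "q \<cdot> u = v \<cdot> \<one> x"
    moreover have "d \<cdot> \<one> x = d" if "d \<in> hom C (Cod C (\<one> x)) (Dom C q)" for d
      using x that by (simp add: hom_iff)
    ultimately show "\<exists>!d. d \<in> hom C (Cod C (\<one> x)) (Dom C q) \<and> d \<cdot> \<one> x = u \<and> q \<cdot> d = v"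
      using x by (intro ex1I[of _ u]) (simp add: hom_iff, metis)
  qed
  then show ?thesis using x by (subst left_class) simp
qed

lemma right_class_Ident [simp]:
  assumes x: "x \<in> Obj C"
  shows "\<one> x \<in> \<M>"
proof -
  have "orthogonal C p (\<one> x)" if p: "p \<in> \<E>" for p
    unfolding orthogonal_def
  proof (intro ballI impI)
    fix u v
    assume "u \<in> hom C (Dom C p) (Dom C (\<one> x))" "v \<in> hom C (Cod C p) (Cod C (\<one> x))" "\<one> x \<cdot> u = v \<cdot> p"
    moreover have "\<one> x \<cdot> d = d" if "d \<in> hom C (Cod C p) (Dom C (\<one> x))" for d
      using x that by (simp add: hom_iff)
    ultimately show "\<exists>!d. d \<in> hom C (Cod C p) (Dom C (\<one> x)) \<and> d \<cdot> p = u \<and> \<one> x \<cdot> d = v"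
      using x by (intro ex1I[of _ v]) (simp add: hom_iff, metis)
  qed
  then show ?thesis using x by (subst right_class) simp
qed

text \<open>The square is filled in two stages: first against \<open>p\<close>, with
  \<open>v \<cdot> p'\<close> as bottom side, then against \<open>p'\<close>, with the first filler
  as top side.\<close>

lemma left_class_Comp:
  assumes p: "p \<in> \<E>" "p' \<in> \<E>" "Dom C p' = Cod C p"
  shows "p' \<cdot> p \<in> \<E>"
proof -
  have "orthogonal C (p' \<cdot> p) q" if q: "q \<in> \<M>" for q
    unfolding orthogonal_def
  proof (intro ballI impI)
    fix u v
    assume u: "u \<in> hom C (Dom C (p' \<cdot> p)) (Dom C q)" and v: "v \<in> hom C (Cod C (p' \<cdot> p)) (Cod C q)"
      and c: "q \<cdot> u = v \<cdot> (p' \<cdot> p)"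
    have [simp]: "u \<in> Arr C" "Dom C u = Dom C p" "Cod C u = Dom C q"
      "v \<in> Arr C" "Dom C v = Cod C p'" "Cod C v = Cod C q"
      using u v p by (simp_all add: hom_iff)
    obtain d where d: "d \<in> hom C (Cod C p) (Dom C q)" "d \<cdot> p = u" "q \<cdot> d = v \<cdot> p'"
      using filler[of p q u "v \<cdot> p'"] p q c by (simp add: hom_iff) metis
    obtain d' where d': "d' \<in> hom C (Cod C p') (Dom C q)" "d' \<cdot> p' = d" "q \<cdot> d' = v"
      using filler[of p' q d v] d(1,3) p q by (simp add: hom_iff) metis
    note [simp] = d(1)[unfolded hom_iff] d'(1)[unfolded hom_iff] p q
    have d'p: "d' \<cdot> (p' \<cdot> p) = u"
      using Comp_assoc_simp[of p p' d'] d(2) d'(2) by simp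
    show "\<exists>!d. d \<in> hom C (Cod C (p' \<cdot> p)) (Dom C q) \<and> d \<cdot> (p' \<cdot> p) = u \<and> q \<cdot> d = v"
    proof (rule ex1I[of _ d'])
      show "d' \<in> hom C (Cod C (p' \<cdot> p)) (Dom C q) \<and> d' \<cdot> (p' \<cdot> p) = u \<and> q \<cdot> d' = v"
        using d'p d'(3) by (simp add: hom_iff)
    next
      fix k
      assume k: "k \<in> hom C (Cod C (p' \<cdot> p)) (Dom C q) \<and> k \<cdot> (p' \<cdot> p) = u \<and> q \<cdot> k = v"
      then have [simp]: "k \<in> Arr C" "Dom C k = Cod C p'" "Cod C k = Dom C q"
        by (simp_all add: hom_iff)
      have qk: "q \<cdot> k = q \<cdot> d'" using k d' by simp
      have qkp': "q \<cdot> k \<cdot> p' = q \<cdot> d' \<cdot> p'"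
        by (rule Comp_reassoc[OF qk]) simp_all
      have kp'p: "k \<cdot> p' \<cdot> p = d' \<cdot> p' \<cdot> p"
        using k d'p by simp
      \<comment> \<open>Uniqueness is peeled off in the same order: \<open>p\<close> is cancelled
        first, which gives the hypothesis for cancelling \<open>p'\<close>.\<close>
      have kp': "k \<cdot> p' = d' \<cdot> p'"
        by (rule filler_unique[of p q]) (simp_all add: qkp' kp'p)
      show "k = d'"
        by (rule filler_unique[of p' q]) (simp_all add: qk kp')
    qed
  qed
  then show ?thesis using p by (subst left_class) simp
qed

text \<open>Dual to the previous argument: the first filler is against \<open>q'\<close>, the second
  against \<open>q\<close>, and uniqueness cancels \<open>q'\<close> before
  \<open>q\<close>.\<close>

lemma right_class_Comp:
  assumes q: "q \<in> \<M>" "q' \<in> \<M>" "Dom C q' = Cod C q"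
  shows "q' \<cdot> q \<in> \<M>"
proof -
  have "orthogonal C p (q' \<cdot> q)" if p: "p \<in> \<E>" for p
    unfolding orthogonal_def
  proof (intro ballI impI)
    fix u v
    assume u: "u \<in> hom C (Dom C p) (Dom C (q' \<cdot> q))" and v: "v \<in> hom C (Cod C p) (Cod C (q' \<cdot> q))"
      and c: "(q' \<cdot> q) \<cdot> u = v \<cdot> p"
    have [simp]: "u \<in> Arr C" "Dom C u = Dom C p" "Cod C u = Dom C q"
      "v \<in> Arr C" "Dom C v = Cod C p" "Cod C v = Cod C q'"
      using u v q by (simp_all add: hom_iff)
    have c': "q' \<cdot> (q \<cdot> u) = v \<cdot> p" using c q by simp
    obtain d where d: "d \<in> hom C (Cod C p) (Dom C q')" "d \<cdot> p = q \<cdot> u" "q' \<cdot> d = v"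
      using filler[of p q' "q \<cdot> u" v] p q c' by (simp add: hom_iff) metis
    obtain d' where d': "d' \<in> hom C (Cod C p) (Dom C q)" "d' \<cdot> p = u" "q \<cdot> d' = d"
      using filler[of p q u d] d(1,2) p q by (simp add: hom_iff) metis
    note [simp] = d(1)[unfolded hom_iff] d'(1)[unfolded hom_iff] p q
    have qd': "(q' \<cdot> q) \<cdot> d' = v"
      using Comp_assoc_simp[of d' q q'] d(3) d'(3) by simp
    show "\<exists>!d. d \<in> hom C (Cod C p) (Dom C (q' \<cdot> q)) \<and> d \<cdot> p = u \<and> (q' \<cdot> q) \<cdot> d = v"
    proof (rule ex1I[of _ d'])
      show "d' \<in> hom C (Cod C p) (Dom C (q' \<cdot> q)) \<and> d' \<cdot> p = u \<and> (q' \<cdot> q) \<cdot> d' = v"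
        using qd' d'(2) by (simp add: hom_iff)
    next
      fix k
      assume k: "k \<in> hom C (Cod C p) (Dom C (q' \<cdot> q)) \<and> k \<cdot> p = u \<and> (q' \<cdot> q) \<cdot> k = v"
      then have [simp]: "k \<in> Arr C" "Dom C k = Cod C p" "Cod C k = Dom C q"
        by (simp_all add: hom_iff)
      have kp: "k \<cdot> p = d' \<cdot> p" using k d' by simp
      have "q' \<cdot> q \<cdot> k = q' \<cdot> q \<cdot> d'"
        using k qd' Comp_assoc_simp[of k q q'] Comp_assoc_simp[of d' q q'] by simp
      then have qk: "q \<cdot> k = q \<cdot> d'"
        by (rule filler_unique[of p q', rotated -1]) (simp_all add: kp)
      show "k = d'"
        by (rule filler_unique[of p q]) (simp_all add: kp qk)
    qed
  qed
  then show ?thesis using q by (subst right_class) simp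
qed

section \<open>Factorisations and their morphisms\<close>

definition factorised :: "'m \<times> 'm \<Rightarrow> bool" where
  "factorised F \<longleftrightarrow> fst F \<in> \<E> \<and> snd F \<in> \<M> \<and> Dom C (snd F) = Cod C (fst F)"

text \<open>The typing of \<open>w\<close> is part of the notion, because \<open>fac_fill\<close>
  selects \<open>w\<close> by a definite description and orthogonality gives uniqueness only within
  a hom set.\<close>

definition fac_mor :: "'m \<times> 'm \<Rightarrow> 'm \<Rightarrow> 'm \<Rightarrow> 'm \<Rightarrow> 'm \<times> 'm \<Rightarrow> bool" where
  "fac_mor F u w v G \<longleftrightarrow>
    u \<in> hom C (Dom C (fst F)) (Dom C (fst G)) \<and>
    w \<in> hom C (Cod C (fst F)) (Cod C (fst G)) \<and>
    v \<in> hom C (Cod C (snd F)) (Cod C (snd G)) \<and>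
    w \<cdot> fst F = fst G \<cdot> u \<and> v \<cdot> snd F = snd G \<cdot> w"

definition fac_fill :: "'m \<times> 'm \<Rightarrow> 'm \<Rightarrow> 'm \<Rightarrow> 'm \<times> 'm \<Rightarrow> 'm" where
  "fac_fill F u v G = (THE w. fac_mor F u w v G)"

text \<open>The middle component is the filler of \<open>fst F\<close> against \<open>snd G\<close>;
  the other two sides of that square are \<open>fst G \<cdot> u\<close> and
  \<open>v \<cdot> snd F\<close>.\<close>

lemma fac_mor_ex1:
  assumes "factorised F" "factorised G"
    and "u \<in> hom C (Dom C (fst F)) (Dom C (fst G))" "v \<in> hom C (Cod C (snd F)) (Cod C (snd G))"
    and "v \<cdot> (snd F \<cdot> fst F) = (snd G \<cdot> fst G) \<cdot> u"
  shows "\<exists>!w. fac_mor F u w v G"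
proof -
  have "\<exists>!d. d \<in> hom C (Cod C (fst F)) (Dom C (snd G)) \<and> d \<cdot> fst F = fst G \<cdot> u \<and>
      snd G \<cdot> d = v \<cdot> snd F"
    using assms by (intro filler) (auto simp: factorised_def hom_iff)
  moreover have "fac_mor F u d v G \<longleftrightarrow> d \<in> hom C (Cod C (fst F)) (Dom C (snd G)) \<and>
      d \<cdot> fst F = fst G \<cdot> u \<and> snd G \<cdot> d = v \<cdot> snd F" for d
    using assms by (auto simp: fac_mor_def factorised_def)
  ultimately show ?thesis by simp
qed

lemma fac_mor_fill:
  assumes "factorised F" "factorised G"
    and "u \<in> hom C (Dom C (fst F)) (Dom C (fst G))" "v \<in> hom C (Cod C (snd F)) (Cod C (snd G))"
    and "v \<cdot> (snd F \<cdot> fst F) = (snd G \<cdot> fst G) \<cdot> u"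
  shows "fac_mor F u (fac_fill F u v G) v G"
  unfolding fac_fill_def by (rule theI'[OF fac_mor_ex1[OF assms]])

lemma fac_mor_outer:
  assumes "factorised F" "factorised G" "fac_mor F u w v G"
  shows "v \<cdot> (snd F \<cdot> fst F) = (snd G \<cdot> fst G) \<cdot> u"
proof -
  note [simp] = assms[unfolded factorised_def fac_mor_def hom_iff]
  have "v \<cdot> (snd F \<cdot> fst F) = snd G \<cdot> (w \<cdot> fst F)"
    by (rule Comp_reassoc) simp_all
  then show ?thesis by simp
qed

lemma fac_mor_unique:
  assumes "factorised F" "factorised G" "fac_mor F u w v G" "fac_mor F u w' v G"
  shows "w = w'"
proof -
  have "u \<in> hom C (Dom C (fst F)) (Dom C (fst G))" "v \<in> hom C (Cod C (snd F)) (Cod C (snd G))"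
    using assms(3) by (simp_all add: fac_mor_def)
  from fac_mor_ex1[OF assms(1,2) this fac_mor_outer[OF assms(1-3)]] assms(3,4)
  show ?thesis by blast
qed

lemma fac_mor_Ident:
  "factorised F \<Longrightarrow>
    fac_mor F (\<one> (Dom C (fst F))) (\<one> (Cod C (fst F))) (\<one> (Cod C (snd F))) F"
  by (simp add: fac_mor_def factorised_def hom_iff)

lemma fac_mor_Comp:
  assumes "factorised F" "factorised G" "factorised H"
    and "fac_mor G u' w' v' H" "fac_mor F u w v G"
  shows "fac_mor F (u' \<cdot> u) (w' \<cdot> w) (v' \<cdot> v) H"
proof -
  note [simp] = assms[unfolded factorised_def fac_mor_def hom_iff]
  have "w' \<cdot> (fst G \<cdot> u) = fst H \<cdot> (u' \<cdot> u)" "v' \<cdot> (snd G \<cdot> w) = snd H \<cdot> (w' \<cdot> w)"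
    by (rule Comp_reassoc; simp)+
  then show ?thesis by (simp add: fac_mor_def hom_iff)
qed

text \<open>The inverted outer square has a filler of its own, and both composites with
  \<open>w\<close> lie over identities.\<close>

lemma fac_mor_inverse:
  assumes F: "factorised F" and G: "factorised G" and w: "fac_mor F u w v G"
    and u': "inverse_arrows C u u'" and v': "inverse_arrows C v v'"
  shows "\<exists>w'. inverse_arrows C w w' \<and> fac_mor G u' w' v' F"
proof -
  have v'G: "v' \<cdot> (snd G \<cdot> fst G) = (snd F \<cdot> fst F) \<cdot> u'"
    by (rule inverse_arrows_square[OF fac_mor_outer[OF F G w] _ _ _ _ _ _ u' v'])
      (use F G w in \<open>simp_all add: factorised_def fac_mor_def hom_iff\<close>)
  note a = F[unfolded factorised_def] G[unfolded factorised_def] w[unfolded fac_mor_def hom_iff]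
    u'[unfolded inverse_arrows_def hom_iff] v'[unfolded inverse_arrows_def hom_iff]
  have "\<exists>!w'. fac_mor G u' w' v' F"
    using v'G by (rule fac_mor_ex1[OF G F, rotated -1]) (use a in \<open>simp_all add: hom_iff\<close>)
  then obtain w' where w': "fac_mor G u' w' v' F" by blast
  \<comment> \<open>The composite is compared with the identity morphism of \<open>F\<close>: both
    have identities as outer components, so their middle components agree.\<close>
  have "w' \<cdot> w = \<one> (Cod C (fst F))"
    by (rule fac_mor_unique[OF F F _ fac_mor_Ident[OF F]])
      (use fac_mor_Comp[OF F G F w' w] a in simp)
  moreover have "w \<cdot> w' = \<one> (Cod C (fst G))"
    by (rule fac_mor_unique[OF G G _ fac_mor_Ident[OF G]])
      (use fac_mor_Comp[OF G F G w w'] a in simp)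
  ultimately have "inverse_arrows C w w'"
    using w w' by (simp add: inverse_arrows_def fac_mor_def hom_iff)
  then show ?thesis using w' by blast
qed

text \<open>The second part concerns \<open>inv_arr\<close> because the second braiding hexagon is
  stated with inverse associators.\<close>

lemma fac_mor_iso:
  assumes "factorised F" "factorised G" "fac_mor F u w v G" "iso C u" "iso C v"
  shows "iso C w" "fac_mor G (inv_arr C u) (inv_arr C w) (inv_arr C v) F"
  using fac_mor_inverse[OF assms(1-3) assms(4,5)[THEN inverse_arrows_inv_arr]] inv_arr_eq
  by (auto simp: iso_def)

text \<open>The way objects enter among factorisations. Tensoring the trivial factorisations of
  \<open>x\<close> and \<open>y\<close> will give the pair of \<open>e (x, y)\<close> and
  \<open>m (x, y)\<close>.\<close>

definition trivial_fac :: "'o \<Rightarrow> 'm \<times> 'm" where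
  "trivial_fac x = (\<one> x, \<one> x)"

lemma factorised_trivial [simp]: "x \<in> Obj C \<Longrightarrow> factorised (trivial_fac x)"
  by (simp add: factorised_def trivial_fac_def)

lemma trivial_fac_simps [simp]: "fst (trivial_fac x) = \<one> x" "snd (trivial_fac x) = \<one> x"
  by (simp_all add: trivial_fac_def)

lemma fac_mor_trivial:
  "g \<in> Arr C \<Longrightarrow> fac_mor (trivial_fac (Dom C g)) g g g (trivial_fac (Cod C g))"
  by (simp add: fac_mor_def hom_iff)

end

section \<open>Monoidal structures and oplax structures on the identity\<close>

sublocale monoidal_category \<subseteq> bifunctor C "tensor T"
  by (intro bifunctor.intro bifunctor_axioms.intro category_axioms tensor_functor)

context monoidal_category
begin

lemma constraint_simps [simp]:
  "unit_obj T \<in> Obj C"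
  "x \<in> Obj C \<Longrightarrow> y \<in> Obj C \<Longrightarrow> z \<in> Obj C \<Longrightarrow> assoc T (x, y, z) \<in> Arr C"
  "x \<in> Obj C \<Longrightarrow> y \<in> Obj C \<Longrightarrow> z \<in> Obj C \<Longrightarrow>
    Dom C (assoc T (x, y, z)) = (x \<odot>\<^bsub>T\<^esub> y) \<odot>\<^bsub>T\<^esub> z"
  "x \<in> Obj C \<Longrightarrow> y \<in> Obj C \<Longrightarrow> z \<in> Obj C \<Longrightarrow>
    Cod C (assoc T (x, y, z)) = x \<odot>\<^bsub>T\<^esub> (y \<odot>\<^bsub>T\<^esub> z)"
  "x \<in> Obj C \<Longrightarrow> lunit T x \<in> Arr C"
  "x \<in> Obj C \<Longrightarrow> Dom C (lunit T x) = unit_obj T \<odot>\<^bsub>T\<^esub> x"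
  "x \<in> Obj C \<Longrightarrow> Cod C (lunit T x) = x"
  "x \<in> Obj C \<Longrightarrow> runit T x \<in> Arr C"
  "x \<in> Obj C \<Longrightarrow> Dom C (runit T x) = x \<odot>\<^bsub>T\<^esub> unit_obj T"
  "x \<in> Obj C \<Longrightarrow> Cod C (runit T x) = x"
  using unit_in nat_trans.component_in[OF nat_iso.axioms(1)[OF assoc_iso], of "(x, y, z)"]
    nat_trans.component_in[OF nat_iso.axioms(1)[OF lunit_iso], of x]
    nat_trans.component_in[OF nat_iso.axioms(1)[OF runit_iso], of x]
  by (simp_all add: hom_iff prod_cat_def id_functor_def)

lemma constraint_iso:
  "x \<in> Obj C \<Longrightarrow> y \<in> Obj C \<Longrightarrow> z \<in> Obj C \<Longrightarrow> iso C (assoc T (x, y, z))"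
  "x \<in> Obj C \<Longrightarrow> iso C (lunit T x)"
  "x \<in> Obj C \<Longrightarrow> iso C (runit T x)"
  using nat_iso.component_iso[OF assoc_iso, of "(x, y, z)"] nat_iso.component_iso[OF lunit_iso]
    nat_iso.component_iso[OF runit_iso]
  by (simp_all add: prod_cat_def)

end

context braided_monoidal_category
begin

lemma braiding_simps [simp]:
  assumes "x \<in> Obj C" "y \<in> Obj C"
  shows "\<beta> (x, y) \<in> Arr C" "Dom C (\<beta> (x, y)) = x \<odot>\<^bsub>T\<^esub> y" "Cod C (\<beta> (x, y)) = y \<odot>\<^bsub>T\<^esub> x"
  using nat_trans.component_in[OF nat_iso.axioms(1)[OF braiding_iso], of "(x, y)"] assms
  by (simp_all add: hom_iff prod_cat_def)

lemma iso_braiding: "x \<in> Obj C \<Longrightarrow> y \<in> Obj C \<Longrightarrow> iso C (\<beta> (x, y))"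
  using nat_iso.component_iso[OF braiding_iso, of "(x, y)"] by (simp add: prod_cat_def)

end

lemma id_functor_simps [simp]: "fobj id_functor = (\<lambda>x. x)" "farr id_functor = (\<lambda>g. g)"
  by (simp_all add: id_functor_def)

lemma ftor_eta [simp]: "\<lparr>fobj = fobj F, farr = farr F\<rparr> = F"
  by (cases F) simp

text \<open>Turns the locale into plain equations in \<open>C\<close>, which serve both to use the
  axioms for \<open>f\<close> and to establish those for \<open>e\<close> and \<open>m\<close>.
  Functoriality of the identity is implied by \<open>C\<close> being a category.\<close>

lemma oplax_monoidal_id_iff:
  "oplax_monoidal_functor C S C T id_functor \<phi>\<^sub>0 \<phi> \<longleftrightarrow>
    monoidal_category C S \<and> monoidal_category C T \<and>
    \<phi>\<^sub>0 \<in> hom C (unit_obj S) (unit_obj T) \<and>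
    nat_trans (C \<times>\<^sub>c C) C (tensor S) (tensor T) \<phi> \<and>
    (\<forall>x \<in> Obj C. lunit T x \<cdot>\<^bsub>C\<^esub> (\<phi>\<^sub>0 \<otimes>\<^bsub>T\<^esub> \<one>\<^bsub>C\<^esub> x) \<cdot>\<^bsub>C\<^esub> \<phi> (unit_obj S, x) = lunit S x) \<and>
    (\<forall>x \<in> Obj C. runit T x \<cdot>\<^bsub>C\<^esub> (\<one>\<^bsub>C\<^esub> x \<otimes>\<^bsub>T\<^esub> \<phi>\<^sub>0) \<cdot>\<^bsub>C\<^esub> \<phi> (x, unit_obj S) = runit S x) \<and>
    (\<forall>x \<in> Obj C. \<forall>y \<in> Obj C. \<forall>z \<in> Obj C.
      (\<one>\<^bsub>C\<^esub> x \<otimes>\<^bsub>T\<^esub> \<phi> (y, z)) \<cdot>\<^bsub>C\<^esub> \<phi> (x, y \<odot>\<^bsub>S\<^esub> z) \<cdot>\<^bsub>C\<^esub> assoc S (x, y, z)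
        = assoc T (x, y, z) \<cdot>\<^bsub>C\<^esub> (\<phi> (x, y) \<otimes>\<^bsub>T\<^esub> \<one>\<^bsub>C\<^esub> z) \<cdot>\<^bsub>C\<^esub> \<phi> (x \<odot>\<^bsub>S\<^esub> y, z))"
    (is "?L \<longleftrightarrow> ?R")
proof -
  have "?L \<longleftrightarrow> cat_functor C C id_functor \<and> ?R"
    unfolding oplax_monoidal_functor_def oplax_monoidal_functor_axioms_def
    by (simp add: Ball_def) blast
  also have "\<dots> \<longleftrightarrow> ?R"
    using category.id_functor[OF monoidal_category.axioms(1)] by blast
  finally show ?thesis .
qed

lemma oplax_braided_id_iff:
  "oplax_braided_monoidal_functor C S \<beta> C T \<gamma> id_functor \<phi>\<^sub>0 \<phi> \<longleftrightarrow>
    braided_monoidal_category C S \<beta> \<and> braided_monoidal_category C T \<gamma> \<and>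
    oplax_monoidal_functor C S C T id_functor \<phi>\<^sub>0 \<phi> \<and>
    (\<forall>x \<in> Obj C. \<forall>y \<in> Obj C. \<gamma> (x, y) \<cdot>\<^bsub>C\<^esub> \<phi> (x, y) = \<phi> (y, x) \<cdot>\<^bsub>C\<^esub> \<beta> (x, y))"
  unfolding oplax_braided_monoidal_functor_def oplax_braided_monoidal_functor_axioms_def
  by (auto simp: Ball_def)

text \<open>Symmetry is a property of the two braidings and imposes no further equation on the
  functor, so the symmetric case reduces to the braided one.\<close>

lemma oplax_symmetric_iff:
  "oplax_symmetric_monoidal_functor C S \<beta> D T \<gamma> F \<phi>\<^sub>0 \<phi> \<longleftrightarrow>
    symmetric_monoidal_category C S \<beta> \<and> symmetric_monoidal_category D T \<gamma> \<and>
    oplax_braided_monoidal_functor C S \<beta> D T \<gamma> F \<phi>\<^sub>0 \<phi>"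
  unfolding oplax_symmetric_monoidal_functor_def by blast

section \<open>The intermediate tensor functor\<close>

text \<open>The factorisations are parameters, constrained only at objects of \<open>C\<close>; no
  canonical choice is made, so all results hold for any choice.\<close>

locale factorised_comparison =
  orthogonal_factorisation_system C \<E> \<M> + T1: monoidal_category C T\<^sub>1 + T2: monoidal_category C T\<^sub>2
  for C :: "('o, 'm) cat" (structure) and \<E> \<M> :: "'m set"
    and T\<^sub>1 T\<^sub>2 :: "('o, 'm) monoidal_structure" +
  fixes f\<^sub>0 :: 'm and f :: "'o \<times> 'o \<Rightarrow> 'm"
    and X :: "'o \<times> 'o \<Rightarrow> 'o" and e m :: "'o \<times> 'o \<Rightarrow> 'm"
    and I :: 'o and e\<^sub>0 m\<^sub>0 :: 'm
  assumes oplax: "oplax_monoidal_functor C T\<^sub>1 C T\<^sub>2 id_functor f\<^sub>0 f"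
    and left_class_tensor: "\<And>g h. g \<in> \<E> \<Longrightarrow> h \<in> \<E> \<Longrightarrow> g \<otimes>\<^bsub>T\<^sub>1\<^esub> h \<in> \<E>"
    and right_class_tensor: "\<And>g h. g \<in> \<M> \<Longrightarrow> h \<in> \<M> \<Longrightarrow> g \<otimes>\<^bsub>T\<^sub>2\<^esub> h \<in> \<M>"
    and factorisation_tensor: "\<And>x y. x \<in> Obj C \<Longrightarrow> y \<in> Obj C \<Longrightarrow>
          e (x, y) \<in> \<E> \<and> e (x, y) \<in> hom C (x \<odot>\<^bsub>T\<^sub>1\<^esub> y) (X (x, y)) \<and>
          m (x, y) \<in> \<M> \<and> m (x, y) \<in> hom C (X (x, y)) (x \<odot>\<^bsub>T\<^sub>2\<^esub> y) \<and>
          m (x, y) \<cdot> e (x, y) = f (x, y)"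
    and factorisation_unit: "e\<^sub>0 \<in> \<E> \<and> e\<^sub>0 \<in> hom C (unit_obj T\<^sub>1) I \<and>
         m\<^sub>0 \<in> \<M> \<and> m\<^sub>0 \<in> hom C I (unit_obj T\<^sub>2) \<and>
         m\<^sub>0 \<cdot> e\<^sub>0 = f\<^sub>0"
begin

lemma unit_simps [simp]:
  "e\<^sub>0 \<in> \<E>" "m\<^sub>0 \<in> \<M>" "Dom C e\<^sub>0 = unit_obj T\<^sub>1" "Cod C e\<^sub>0 = I"
  "Dom C m\<^sub>0 = I" "Cod C m\<^sub>0 = unit_obj T\<^sub>2" "m\<^sub>0 \<cdot> e\<^sub>0 = f\<^sub>0"
  using factorisation_unit by (simp_all add: hom_iff)

lemma unit_Obj [simp]: "I \<in> Obj C"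
  using Cod_in[of e\<^sub>0] by simp

lemma f0_simps [simp]: "f\<^sub>0 \<in> Arr C" "Dom C f\<^sub>0 = unit_obj T\<^sub>1" "Cod C f\<^sub>0 = unit_obj T\<^sub>2"
  using oplax[unfolded oplax_monoidal_id_iff] by (simp_all add: hom_iff)

sublocale F: tensor_comparison C "tensor T\<^sub>1" "tensor T\<^sub>2" f
  using oplax[unfolded oplax_monoidal_id_iff] T1.bifunctor_axioms T2.bifunctor_axioms
  by (intro tensor_comparison.intro tensor_comparison_axioms.intro) simp_all

lemma factor_simps [simp]:
  assumes "x \<in> Obj C" "y \<in> Obj C"
  shows "e (x, y) \<in> \<E>" "m (x, y) \<in> \<M>" "Dom C (e (x, y)) = x \<odot>\<^bsub>T\<^sub>1\<^esub> y" "Cod C (m (x, y)) = x \<odot>\<^bsub>T\<^sub>2\<^esub> y"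
    "m (x, y) \<cdot> e (x, y) = f (x, y)"
  using factorisation_tensor[OF assms] by (simp_all add: hom_iff)

definition component_fac :: "'o \<times> 'o \<Rightarrow> 'm \<times> 'm" where
  "component_fac xy = (e xy, m xy)"

lemma component_fac_simps [simp]:
  "fst (component_fac xy) = e xy" "snd (component_fac xy) = m xy"
  by (simp_all add: component_fac_def)

definition fill_tensor :: "('o \<times> 'o, 'm \<times> 'm, 'o, 'm) ftor" where
  "fill_tensor = \<lparr>fobj = X,
    farr = (\<lambda>(g, h). fac_fill (component_fac (Dom C g, Dom C h)) (g \<otimes>\<^bsub>T\<^sub>1\<^esub> h) (g \<otimes>\<^bsub>T\<^sub>2\<^esub> h)
      (component_fac (Cod C g, Cod C h)))\<rparr>"

lemma factorised_component [simp]: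
  assumes "x \<in> Obj C" "y \<in> Obj C"
  shows "factorised (component_fac (x, y))"
  using factorisation_tensor[OF assms] by (simp add: factorised_def hom_iff)

text \<open>The outer square is naturality of \<open>f\<close>. Of the two squares obtained, one
  will be naturality of \<open>e\<close> and the other naturality of \<open>m\<close>.\<close>

lemma fac_mor_fill_tensor:
  assumes "g \<in> Arr C" "h \<in> Arr C"
  shows "fac_mor (component_fac (Dom C g, Dom C h)) (g \<otimes>\<^bsub>T\<^sub>1\<^esub> h) (farr fill_tensor (g, h))
    (g \<otimes>\<^bsub>T\<^sub>2\<^esub> h) (component_fac (Cod C g, Cod C h))"
proof -
  have "(g \<otimes>\<^bsub>T\<^sub>2\<^esub> h) \<cdot> f (Dom C g, Dom C h) = f (Cod C g, Cod C h) \<cdot> (g \<otimes>\<^bsub>T\<^sub>1\<^esub> h)"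
    using assms by (simp add: F.component_natural)
  then show ?thesis
    unfolding fill_tensor_def ftor.simps prod.case
    using assms by (intro fac_mor_fill) (simp_all add: hom_iff)
qed

text \<open>Functoriality is inherited from the two outer tensor functors: each functor law compares
  two middle components lying over the same outer arrows.\<close>

lemma intermediate_fill_tensor: "intermediate_tensor C T\<^sub>1 T\<^sub>2 X e m fill_tensor"
proof -
  have X [simp]: "X (x, y) \<in> Obj C" "Cod C (e (x, y)) = X (x, y)" "Dom C (m (x, y)) = X (x, y)"
    if "x \<in> Obj C" "y \<in> Obj C" for x y
    using factorisation_tensor[OF that] Cod_in[of "e (x, y)"] by (auto simp: hom_iff)
  have farr [simp]: "farr fill_tensor (g, h) \<in> Arr C"
    "Dom C (farr fill_tensor (g, h)) = X (Dom C g, Dom C h)"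
    "Cod C (farr fill_tensor (g, h)) = X (Cod C g, Cod C h)"
    if "g \<in> Arr C" "h \<in> Arr C" for g h
    using fac_mor_fill_tensor[OF that] that by (simp_all add: fac_mor_def hom_iff)
  \<comment> \<open>Both outer tensor functors send the pair of identities to an identity, so the
    filler competes with the identity morphism of the factorisation.\<close>
  have id: "farr fill_tensor (\<one> x, \<one> y) = \<one> (X (x, y))" if "x \<in> Obj C" "y \<in> Obj C" for x y
    using fac_mor_fill_tensor[of "\<one> x" "\<one> y"] fac_mor_Ident[of "component_fac (x, y)"] that
    by (intro fac_mor_unique[of "component_fac (x, y)" "component_fac (x, y)"
          "\<one> (x \<odot>\<^bsub>T\<^sub>1\<^esub> y)" _ "\<one> (x \<odot>\<^bsub>T\<^sub>2\<^esub> y)"]) simp_all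
  \<comment> \<open>The composite of the two fillers lies over composites of tensored arrows, and
    these are the tensored composites by functoriality of the outer structures.\<close>
  have comp: "farr fill_tensor (g' \<cdot> g, h' \<cdot> h) = farr fill_tensor (g', h') \<cdot> farr fill_tensor (g, h)"
    if a: "g \<in> Arr C" "h \<in> Arr C" "g' \<in> Arr C" "h' \<in> Arr C" "Dom C g' = Cod C g" "Dom C h' = Cod C h"
    for g h g' h'
  proof (rule fac_mor_unique)
    let ?S = "component_fac (Dom C g, Dom C h)" and ?G = "component_fac (Cod C g, Cod C h)"
      and ?H = "component_fac (Cod C g', Cod C h')"
    show "factorised ?S" "factorised ?H" using a by simp_all
    show "fac_mor ?S ((g' \<cdot> g) \<otimes>\<^bsub>T\<^sub>1\<^esub> (h' \<cdot> h)) (farr fill_tensor (g' \<cdot> g, h' \<cdot> h))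
        ((g' \<cdot> g) \<otimes>\<^bsub>T\<^sub>2\<^esub> (h' \<cdot> h)) ?H"
      using fac_mor_fill_tensor[of "g' \<cdot> g" "h' \<cdot> h"] a by simp
    have "fac_mor ?G (g' \<otimes>\<^bsub>T\<^sub>1\<^esub> h') (farr fill_tensor (g', h')) (g' \<otimes>\<^bsub>T\<^sub>2\<^esub> h') ?H"
      using fac_mor_fill_tensor[of g' h'] a by simp
    then show "fac_mor ?S ((g' \<cdot> g) \<otimes>\<^bsub>T\<^sub>1\<^esub> (h' \<cdot> h)) (farr fill_tensor (g', h') \<cdot> farr fill_tensor (g, h))
        ((g' \<cdot> g) \<otimes>\<^bsub>T\<^sub>2\<^esub> (h' \<cdot> h)) ?H"
      using fac_mor_Comp[OF _ _ _ _ fac_mor_fill_tensor[of g h]] a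
      by (simp add: T1.farr_Comp T2.farr_Comp)
  qed
  have fobj [simp]: "fobj fill_tensor = X" by (simp add: fill_tensor_def)
  interpret CC: category "C \<times>\<^sub>c C" by (intro category_prod_cat category_axioms)
  have P: "cat_functor (C \<times>\<^sub>c C) C fill_tensor"
    by unfold_locales (auto simp: prod_cat_def hom_iff id comp)
  interpret P: cat_functor "C \<times>\<^sub>c C" C fill_tensor by (rule P)
  interpret T1: cat_functor "C \<times>\<^sub>c C" C "tensor T\<^sub>1" by (rule T1.tensor_functor)
  interpret T2: cat_functor "C \<times>\<^sub>c C" C "tensor T\<^sub>2" by (rule T2.tensor_functor)
  have nat: "e (Cod C g, Cod C h) \<cdot> (g \<otimes>\<^bsub>T\<^sub>1\<^esub> h) = farr fill_tensor (g, h) \<cdot> e (Dom C g, Dom C h)"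
    "m (Cod C g, Cod C h) \<cdot> farr fill_tensor (g, h) = (g \<otimes>\<^bsub>T\<^sub>2\<^esub> h) \<cdot> m (Dom C g, Dom C h)"
    if "g \<in> Arr C" "h \<in> Arr C" for g h
    using fac_mor_fill_tensor[OF that] by (simp_all add: fac_mor_def)
  have "nat_trans (C \<times>\<^sub>c C) C (tensor T\<^sub>1) fill_tensor e"
    by unfold_locales (auto simp: prod_cat_def hom_iff nat)
  moreover have "nat_trans (C \<times>\<^sub>c C) C fill_tensor (tensor T\<^sub>2) m"
    by unfold_locales (auto simp: prod_cat_def hom_iff nat)
  ultimately show ?thesis
    using P by (simp add: intermediate_tensor_def)
qed

end

section \<open>Tensor products of factorisations\<close>

text \<open>\<open>P\<close> stays arbitrary because the theorem concerns every intermediate tensor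
  functor. All that is used of it is functoriality and naturality of \<open>e\<close> and
  \<open>m\<close>.\<close>

locale intermediate_comparison = factorised_comparison C \<E> \<M> T\<^sub>1 T\<^sub>2 f\<^sub>0 f X e m I e\<^sub>0 m\<^sub>0
  for C :: "('o, 'm) cat" (structure) and \<E> \<M> :: "'m set"
    and T\<^sub>1 T\<^sub>2 :: "('o, 'm) monoidal_structure"
    and f\<^sub>0 :: 'm and f :: "'o \<times> 'o \<Rightarrow> 'm"
    and X :: "'o \<times> 'o \<Rightarrow> 'o" and e m :: "'o \<times> 'o \<Rightarrow> 'm"
    and I :: 'o and e\<^sub>0 m\<^sub>0 :: 'm +
  fixes P :: "('o \<times> 'o, 'm \<times> 'm, 'o, 'm) ftor"
  assumes intermediate: "intermediate_tensor C T\<^sub>1 T\<^sub>2 X e m P"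
begin

sublocale P: bifunctor C P
  using intermediate category_axioms
  by (intro bifunctor.intro bifunctor_axioms.intro) (simp_all add: intermediate_tensor_def)

sublocale E: tensor_comparison C "tensor T\<^sub>1" P e
  using intermediate T1.bifunctor_axioms P.bifunctor_axioms
  by (intro tensor_comparison.intro tensor_comparison_axioms.intro)
    (simp_all add: intermediate_tensor_def)

sublocale M: tensor_comparison C P "tensor T\<^sub>2" m
  using intermediate T2.bifunctor_axioms P.bifunctor_axioms
  by (intro tensor_comparison.intro tensor_comparison_axioms.intro)
    (simp_all add: intermediate_tensor_def)

text \<open>The two halves meet at \<open>P\<close> applied to the middle objects, while the ends
  are tensored in the outer structures; diagonals are what connects one tensor product to the
  next.\<close>

definition fac_tensor :: "'m \<times> 'm \<Rightarrow> 'm \<times> 'm \<Rightarrow> 'm \<times> 'm" (infixr "\<boxtimes>" 70) where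
  "F \<boxtimes> G = (E.diagonal (fst F) (fst G), M.diagonal (snd F) (snd G))"

abbreviation unit_fac :: "'m \<times> 'm" where
  "unit_fac \<equiv> (e\<^sub>0, m\<^sub>0)"

lemma fac_tensor_simps [simp]:
  "fst (F \<boxtimes> G) = E.diagonal (fst F) (fst G)" "snd (F \<boxtimes> G) = M.diagonal (snd F) (snd G)"
  by (simp_all add: fac_tensor_def)

lemma factorised_arr [simp]:
  assumes "factorised F"
  shows "fst F \<in> Arr C" "snd F \<in> Arr C" "Dom C (snd F) = Cod C (fst F)"
  using assms by (simp_all add: factorised_def)

lemma factorised_unit [simp]: "factorised unit_fac"
  by (simp add: factorised_def)

text \<open>Each half is written so that its closure assumption applies: a
  \<open>\<otimes>\<^sub>1\<close>-product of \<E>-maps followed by \<open>e\<close>, and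
  \<open>m\<close> followed by a \<open>\<otimes>\<^sub>2\<close>-product of \<M>-maps.\<close>

lemma factorised_tensor [simp]:
  assumes F: "factorised F" and G: "factorised G"
  shows "factorised (F \<boxtimes> G)"
proof -
  have "E.diagonal (fst F) (fst G) \<in> \<E>"
    using F G by (simp add: E.diagonal_eq left_class_Comp left_class_tensor factorised_def)
  moreover have "M.diagonal (snd F) (snd G) \<in> \<M>"
    using F G by (simp add: M.diagonal_def right_class_Comp right_class_tensor factorised_def)
  ultimately show ?thesis
    using F G by (simp add: factorised_def)
qed

text \<open>The facing components \<open>m\<close> and \<open>e\<close> compose to \<open>f\<close>
  at the middle objects. Hence the composites of iterated tensor products are iterated diagonals of
  \<open>f\<close>, the expressions in the oplax axioms for \<open>f\<close>.\<close>

lemma fac_tensor_composite: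
  assumes "factorised F" "factorised G"
  shows "M.diagonal (snd F) (snd G) \<cdot> E.diagonal (fst F) (fst G)
    = F.diagonal (snd F \<cdot> fst F) (snd G \<cdot> fst G)"
proof -
  let ?z = "(Cod C (fst F), Cod C (fst G))"
  \<comment> \<open>The rule contracting \<open>m ?z \<cdot> e ?z\<close> to \<open>f ?z\<close> is
    withheld here: on the right-nested left side the two factors are not adjacent as a subterm, and
    both sides have to normalise alike.\<close>
  have "M.diagonal (snd F) (snd G) \<cdot> E.diagonal (fst F) (fst G)
      = farr (tensor T\<^sub>2) (snd F, snd G) \<cdot> (m ?z \<cdot> e ?z) \<cdot> farr (tensor T\<^sub>1) (fst F, fst G)"
    using assms by (simp add: M.diagonal_def E.diagonal_eq del: factor_simps(5))
  also have "\<dots> = farr (tensor T\<^sub>2) (snd F, snd G) \<cdot> F.diagonal (fst F) (fst G)"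
    using assms by (simp add: F.diagonal_eq)
  also have "\<dots> = F.diagonal (snd F \<cdot> fst F) (snd G \<cdot> fst G)"
    using assms by (simp add: F.diagonal_postcomp)
  finally show ?thesis .
qed

text \<open>In each square the later arrows are absorbed into the diagonal, the given squares are
  applied inside its arguments, and the earlier arrows are released on the other side.\<close>

lemma fac_mor_tensor:
  assumes "factorised F" "factorised F'" "factorised G" "factorised G'"
    and "fac_mor F u w v G" "fac_mor F' u' w' v' G'"
  shows "fac_mor (F \<boxtimes> F') (u \<otimes>\<^bsub>T\<^sub>1\<^esub> u') (farr P (w, w')) (v \<otimes>\<^bsub>T\<^sub>2\<^esub> v') (G \<boxtimes> G')"
proof -
  note a = assms(1-4)[THEN factorised_arr(1)] assms(1-4)[THEN factorised_arr(2)]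
    assms(1-4)[THEN factorised_arr(3)]
  have h: "u \<in> Arr C" "Dom C u = Dom C (fst F)" "Cod C u = Dom C (fst G)"
    "w \<in> Arr C" "Dom C w = Cod C (fst F)" "Cod C w = Cod C (fst G)"
    "v \<in> Arr C" "Dom C v = Cod C (snd F)" "Cod C v = Cod C (snd G)"
    "u' \<in> Arr C" "Dom C u' = Dom C (fst F')" "Cod C u' = Dom C (fst G')"
    "w' \<in> Arr C" "Dom C w' = Cod C (fst F')" "Cod C w' = Cod C (fst G')"
    "v' \<in> Arr C" "Dom C v' = Cod C (snd F')" "Cod C v' = Cod C (snd G')"
    and eq: "w \<cdot> fst F = fst G \<cdot> u" "v \<cdot> snd F = snd G \<cdot> w"
    "w' \<cdot> fst F' = fst G' \<cdot> u'" "v' \<cdot> snd F' = snd G' \<cdot> w'"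
    using assms(5,6) by (simp_all add: fac_mor_def hom_iff)
  have "farr P (w, w') \<cdot> E.diagonal (fst F) (fst F') = E.diagonal (fst G) (fst G') \<cdot> (u \<otimes>\<^bsub>T\<^sub>1\<^esub> u')"
    using a h eq E.diagonal_postcomp[of "fst F" "fst F'" w w']
      E.diagonal_precomp[of "fst G" "fst G'" u u'] by simp
  moreover have "(v \<otimes>\<^bsub>T\<^sub>2\<^esub> v') \<cdot> M.diagonal (snd F) (snd F') = M.diagonal (snd G) (snd G') \<cdot> farr P (w, w')"
    using a h eq M.diagonal_postcomp[of "snd F" "snd F'" v v']
      M.diagonal_precomp[of "snd G" "snd G'" w w'] by simp
  ultimately show ?thesis
    using a h by (simp add: fac_mor_def hom_iff)
qed

section \<open>The constraints of the intermediate structure\<close>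

abbreviation (input) assoc_dom :: "'o \<Rightarrow> 'o \<Rightarrow> 'o \<Rightarrow> 'm \<times> 'm" where
  "assoc_dom x y z \<equiv> (trivial_fac x \<boxtimes> trivial_fac y) \<boxtimes> trivial_fac z"

abbreviation (input) assoc_cod :: "'o \<Rightarrow> 'o \<Rightarrow> 'o \<Rightarrow> 'm \<times> 'm" where
  "assoc_cod x y z \<equiv> trivial_fac x \<boxtimes> (trivial_fac y \<boxtimes> trivial_fac z)"

text \<open>The fields are indexed by objects, so the fillers are taken at trivial factorisations.
  Their meaning at other factorisations is established after naturality.\<close>

definition mid_structure :: "('o, 'm) monoidal_structure" where
  "mid_structure = \<lparr>tensor = P, unit_obj = I,
    assoc = (\<lambda>(x, y, z). fac_fill (assoc_dom x y z) (assoc T\<^sub>1 (x, y, z)) (assoc T\<^sub>2 (x, y, z))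
      (assoc_cod x y z)),
    lunit = (\<lambda>x. fac_fill (unit_fac \<boxtimes> trivial_fac x) (lunit T\<^sub>1 x) (lunit T\<^sub>2 x) (trivial_fac x)),
    runit = (\<lambda>x. fac_fill (trivial_fac x \<boxtimes> unit_fac) (runit T\<^sub>1 x) (runit T\<^sub>2 x) (trivial_fac x))\<rparr>"

lemma mid_structure_simps [simp]: "tensor mid_structure = P" "unit_obj mid_structure = I"
  by (simp_all add: mid_structure_def)

text \<open>The outer square is the oplax associativity axiom for \<open>f\<close>, once the
  composites of source and target are recognised as iterated diagonals of \<open>f\<close> at
  identities.\<close>

lemma fac_mor_assoc_trivial:
  assumes "x \<in> Obj C" "y \<in> Obj C" "z \<in> Obj C"
  shows "fac_mor (assoc_dom x y z) (assoc T\<^sub>1 (x, y, z)) (assoc mid_structure (x, y, z))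
    (assoc T\<^sub>2 (x, y, z)) (assoc_cod x y z)"
proof -
  have "(\<one> x \<otimes>\<^bsub>T\<^sub>2\<^esub> f (y, z)) \<cdot> f (x, y \<odot>\<^bsub>T\<^sub>1\<^esub> z) \<cdot> assoc T\<^sub>1 (x, y, z)
    = assoc T\<^sub>2 (x, y, z) \<cdot> (f (x, y) \<otimes>\<^bsub>T\<^sub>2\<^esub> \<one> z) \<cdot> f (x \<odot>\<^bsub>T\<^sub>1\<^esub> y, z)"
    using oplax[unfolded oplax_monoidal_id_iff] assms by simp
  moreover have "snd (assoc_dom x y z) \<cdot> fst (assoc_dom x y z)
      = F.diagonal (F.diagonal (\<one> x) (\<one> y)) (\<one> z)"
    "snd (assoc_cod x y z) \<cdot> fst (assoc_cod x y z) = F.diagonal (\<one> x) (F.diagonal (\<one> y) (\<one> z))"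
    using assms fac_tensor_composite[of "trivial_fac x \<boxtimes> trivial_fac y" "trivial_fac z"]
      fac_tensor_composite[of "trivial_fac x" "trivial_fac y"]
      fac_tensor_composite[of "trivial_fac x" "trivial_fac y \<boxtimes> trivial_fac z"]
      fac_tensor_composite[of "trivial_fac y" "trivial_fac z"]
    by simp_all
  ultimately show ?thesis
    unfolding mid_structure_def monoidal_structure.simps prod.case using assms
    by (intro fac_mor_fill) (simp_all add: hom_iff F.diagonal_def)
qed

text \<open>The unit enters as \<open>unit_fac\<close> and not as \<open>trivial_fac I\<close>,
  since its outer objects have to be the units of the outer structures. Its composite is
  \<open>f\<^sub>0\<close>, which makes the outer square the oplax unit axiom.\<close>

lemma fac_mor_lunit_trivial:
  assumes "x \<in> Obj C"
  shows "fac_mor (unit_fac \<boxtimes> trivial_fac x) (lunit T\<^sub>1 x) (lunit mid_structure x) (lunit T\<^sub>2 x)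
    (trivial_fac x)"
proof -
  have "lunit T\<^sub>2 x \<cdot> (f\<^sub>0 \<otimes>\<^bsub>T\<^sub>2\<^esub> \<one> x) \<cdot> f (unit_obj T\<^sub>1, x) = lunit T\<^sub>1 x"
    using oplax[unfolded oplax_monoidal_id_iff] assms by simp
  moreover have "snd (unit_fac \<boxtimes> trivial_fac x) \<cdot> fst (unit_fac \<boxtimes> trivial_fac x)
      = F.diagonal f\<^sub>0 (\<one> x)"
    using assms fac_tensor_composite[of unit_fac "trivial_fac x"] by simp
  ultimately show ?thesis
    unfolding mid_structure_def monoidal_structure.simps using assms
    by (intro fac_mor_fill) (simp_all add: hom_iff F.diagonal_def)
qed

lemma fac_mor_runit_trivial:
  assumes "x \<in> Obj C"
  shows "fac_mor (trivial_fac x \<boxtimes> unit_fac) (runit T\<^sub>1 x) (runit mid_structure x) (runit T\<^sub>2 x)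
    (trivial_fac x)"
proof -
  have "runit T\<^sub>2 x \<cdot> (\<one> x \<otimes>\<^bsub>T\<^sub>2\<^esub> f\<^sub>0) \<cdot> f (x, unit_obj T\<^sub>1) = runit T\<^sub>1 x"
    using oplax[unfolded oplax_monoidal_id_iff] assms by simp
  moreover have "snd (trivial_fac x \<boxtimes> unit_fac) \<cdot> fst (trivial_fac x \<boxtimes> unit_fac)
      = F.diagonal (\<one> x) f\<^sub>0"
    using assms fac_tensor_composite[of "trivial_fac x" unit_fac] by simp
  ultimately show ?thesis
    unfolding mid_structure_def monoidal_structure.simps using assms
    by (intro fac_mor_fill) (simp_all add: hom_iff F.diagonal_def)
qed

lemma assoc_mid_simps [simp]:
  assumes "x \<in> Obj C" "y \<in> Obj C" "z \<in> Obj C"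
  shows "assoc mid_structure (x, y, z) \<in> Arr C"
    "Dom C (assoc mid_structure (x, y, z)) = fobj P (fobj P (x, y), z)"
    "Cod C (assoc mid_structure (x, y, z)) = fobj P (x, fobj P (y, z))"
  using fac_mor_assoc_trivial[OF assms] assms by (simp_all add: fac_mor_def hom_iff)

lemma assoc_mid_coherence:
  assumes "x \<in> Obj C" "y \<in> Obj C" "z \<in> Obj C"
  shows "assoc mid_structure (x, y, z) \<cdot> E.diagonal (E.diagonal (\<one> x) (\<one> y)) (\<one> z)
      = E.diagonal (\<one> x) (E.diagonal (\<one> y) (\<one> z)) \<cdot> assoc T\<^sub>1 (x, y, z)"
    and "assoc T\<^sub>2 (x, y, z) \<cdot> M.diagonal (M.diagonal (\<one> x) (\<one> y)) (\<one> z)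
      = M.diagonal (\<one> x) (M.diagonal (\<one> y) (\<one> z)) \<cdot> assoc mid_structure (x, y, z)"
  using fac_mor_assoc_trivial[OF assms] by (simp_all add: fac_mor_def)

lemma unit_mid_simps [simp]:
  assumes "x \<in> Obj C"
  shows "lunit mid_structure x \<in> Arr C" "Dom C (lunit mid_structure x) = fobj P (I, x)"
    "Cod C (lunit mid_structure x) = x"
    "runit mid_structure x \<in> Arr C" "Dom C (runit mid_structure x) = fobj P (x, I)"
    "Cod C (runit mid_structure x) = x"
  using fac_mor_lunit_trivial[OF assms] fac_mor_runit_trivial[OF assms] assms
  by (simp_all add: fac_mor_def hom_iff)

section \<open>Naturality and invertibility of the constraints\<close>

lemma fac_mor_Ident_trivial:
  "x \<in> Obj C \<Longrightarrow> fac_mor (trivial_fac x) (\<one> x) (\<one> x) (\<one> x) (trivial_fac x)"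
  using fac_mor_Ident[of "trivial_fac x"] by simp

lemma fac_mor_Ident_unit:
  "fac_mor unit_fac (\<one> (unit_obj T\<^sub>1)) (\<one> I) (\<one> (unit_obj T\<^sub>2)) unit_fac"
  using fac_mor_Ident[of unit_fac] by simp

text \<open>The form in which uniqueness is applied: the outer components may be different terms,
  and the goals \<open>u = u'\<close> and \<open>v = v'\<close> are then the corresponding laws of
  the outer structures.\<close>

lemma fac_mor_eq:
  assumes "fac_mor F u w v G" "fac_mor F u' w' v' G" "u = u'" "v = v'" "factorised F" "factorised G"
  shows "w = w'"
  using fac_mor_unique assms by blast

text \<open>An arrow, taken in all three positions, is a morphism between trivial factorisations.
  Composing tensor products of such morphisms with the associator in either order reduces naturality
  to that of the outer associators.\<close>

lemma assoc_mid_natural: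
  assumes [simp]: "p \<in> Arr C" "q \<in> Arr C" "r \<in> Arr C"
  shows "assoc mid_structure (Cod C p, Cod C q, Cod C r) \<cdot> farr P (farr P (p, q), r)
    = farr P (p, farr P (q, r)) \<cdot> assoc mid_structure (Dom C p, Dom C q, Dom C r)"
proof (rule fac_mor_eq)
  let ?D = "\<lambda>g. trivial_fac (Dom C g)" and ?C = "\<lambda>g. trivial_fac (Cod C g)"
  note t = fac_mor_trivial[of p] fac_mor_trivial[of q] fac_mor_trivial[of r]
  show "fac_mor ((?D p \<boxtimes> ?D q) \<boxtimes> ?D r)
      (assoc T\<^sub>1 (Cod C p, Cod C q, Cod C r) \<cdot> ((p \<otimes>\<^bsub>T\<^sub>1\<^esub> q) \<otimes>\<^bsub>T\<^sub>1\<^esub> r))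
      (assoc mid_structure (Cod C p, Cod C q, Cod C r) \<cdot> farr P (farr P (p, q), r))
      (assoc T\<^sub>2 (Cod C p, Cod C q, Cod C r) \<cdot> ((p \<otimes>\<^bsub>T\<^sub>2\<^esub> q) \<otimes>\<^bsub>T\<^sub>2\<^esub> r))
      (?C p \<boxtimes> (?C q \<boxtimes> ?C r))"
    by (rule fac_mor_Comp[OF _ _ _ fac_mor_assoc_trivial]) (simp_all add: fac_mor_tensor t)
  show "fac_mor ((?D p \<boxtimes> ?D q) \<boxtimes> ?D r)
      ((p \<otimes>\<^bsub>T\<^sub>1\<^esub> (q \<otimes>\<^bsub>T\<^sub>1\<^esub> r)) \<cdot> assoc T\<^sub>1 (Dom C p, Dom C q, Dom C r))
      (farr P (p, farr P (q, r)) \<cdot> assoc mid_structure (Dom C p, Dom C q, Dom C r))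
      ((p \<otimes>\<^bsub>T\<^sub>2\<^esub> (q \<otimes>\<^bsub>T\<^sub>2\<^esub> r)) \<cdot> assoc T\<^sub>2 (Dom C p, Dom C q, Dom C r))
      (?C p \<boxtimes> (?C q \<boxtimes> ?C r))"
    by (rule fac_mor_Comp[OF _ _ _ _ fac_mor_assoc_trivial]) (simp_all add: fac_mor_tensor t)
  have h: "(p, q, r) \<in> hom (C \<times>\<^sub>c C \<times>\<^sub>c C) (Dom C p, Dom C q, Dom C r) (Cod C p, Cod C q, Cod C r)"
    by (simp add: hom_iff prod_cat_def)
  show "assoc T\<^sub>1 (Cod C p, Cod C q, Cod C r) \<cdot> ((p \<otimes>\<^bsub>T\<^sub>1\<^esub> q) \<otimes>\<^bsub>T\<^sub>1\<^esub> r)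
      = (p \<otimes>\<^bsub>T\<^sub>1\<^esub> (q \<otimes>\<^bsub>T\<^sub>1\<^esub> r)) \<cdot> assoc T\<^sub>1 (Dom C p, Dom C q, Dom C r)"
    using nat_trans.naturality[OF nat_iso.axioms(1)[OF T1.assoc_iso] h] by simp
  show "assoc T\<^sub>2 (Cod C p, Cod C q, Cod C r) \<cdot> ((p \<otimes>\<^bsub>T\<^sub>2\<^esub> q) \<otimes>\<^bsub>T\<^sub>2\<^esub> r)
      = (p \<otimes>\<^bsub>T\<^sub>2\<^esub> (q \<otimes>\<^bsub>T\<^sub>2\<^esub> r)) \<cdot> assoc T\<^sub>2 (Dom C p, Dom C q, Dom C r)"
    using nat_trans.naturality[OF nat_iso.axioms(1)[OF T2.assoc_iso] h] by simp
qed simp_all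

lemma nat_iso_assoc_mid:
  "nat_iso (C \<times>\<^sub>c C \<times>\<^sub>c C) C
    \<lparr>fobj = (\<lambda>(x, y, z). fobj P (fobj P (x, y), z)), farr = (\<lambda>(f, g, h). farr P (farr P (f, g), h))\<rparr>
    \<lparr>fobj = (\<lambda>(x, y, z). fobj P (x, fobj P (y, z))), farr = (\<lambda>(f, g, h). farr P (f, farr P (g, h)))\<rparr>
    (assoc mid_structure)"
proof (intro nat_iso.intro nat_trans.intro nat_trans_axioms.intro nat_iso_axioms.intro
    P.left_triple_functor P.right_triple_functor)
  fix xyz
  assume "xyz \<in> Obj (C \<times>\<^sub>c C \<times>\<^sub>c C)"
  then obtain x y z where [simp]: "xyz = (x, y, z)" "x \<in> Obj C" "y \<in> Obj C" "z \<in> Obj C"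
    by (auto simp: prod_cat_def)
  show "iso C (assoc mid_structure xyz)"
    using fac_mor_iso(1)[OF _ _ fac_mor_assoc_trivial T1.constraint_iso(1) T2.constraint_iso(1)]
    by simp
qed (auto simp: prod_cat_def hom_iff assoc_mid_natural)

lemma lunit_mid_natural:
  assumes [simp]: "p \<in> Arr C"
  shows "lunit mid_structure (Cod C p) \<cdot> farr P (\<one> I, p) = p \<cdot> lunit mid_structure (Dom C p)"
proof (rule fac_mor_eq)
  show "fac_mor (unit_fac \<boxtimes> trivial_fac (Dom C p))
      (lunit T\<^sub>1 (Cod C p) \<cdot> (\<one> (unit_obj T\<^sub>1) \<otimes>\<^bsub>T\<^sub>1\<^esub> p)) (lunit mid_structure (Cod C p) \<cdot> farr P (\<one> I, p))
      (lunit T\<^sub>2 (Cod C p) \<cdot> (\<one> (unit_obj T\<^sub>2) \<otimes>\<^bsub>T\<^sub>2\<^esub> p)) (trivial_fac (Cod C p))"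
    by (rule fac_mor_Comp[OF _ _ _ fac_mor_lunit_trivial])
      (simp_all add: fac_mor_tensor fac_mor_trivial fac_mor_Ident_unit)
  show "fac_mor (unit_fac \<boxtimes> trivial_fac (Dom C p))
      (p \<cdot> lunit T\<^sub>1 (Dom C p)) (p \<cdot> lunit mid_structure (Dom C p)) (p \<cdot> lunit T\<^sub>2 (Dom C p))
      (trivial_fac (Cod C p))"
    by (rule fac_mor_Comp[OF _ _ _ _ fac_mor_lunit_trivial]) (simp_all add: fac_mor_trivial)
qed (use nat_trans.naturality[OF nat_iso.axioms(1)[OF T1.lunit_iso], of p "Dom C p" "Cod C p"]
      nat_trans.naturality[OF nat_iso.axioms(1)[OF T2.lunit_iso], of p "Dom C p" "Cod C p"]
    in \<open>simp_all add: hom_iff\<close>)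

lemma runit_mid_natural:
  assumes [simp]: "p \<in> Arr C"
  shows "runit mid_structure (Cod C p) \<cdot> farr P (p, \<one> I) = p \<cdot> runit mid_structure (Dom C p)"
proof (rule fac_mor_eq)
  show "fac_mor (trivial_fac (Dom C p) \<boxtimes> unit_fac)
      (runit T\<^sub>1 (Cod C p) \<cdot> (p \<otimes>\<^bsub>T\<^sub>1\<^esub> \<one> (unit_obj T\<^sub>1))) (runit mid_structure (Cod C p) \<cdot> farr P (p, \<one> I))
      (runit T\<^sub>2 (Cod C p) \<cdot> (p \<otimes>\<^bsub>T\<^sub>2\<^esub> \<one> (unit_obj T\<^sub>2))) (trivial_fac (Cod C p))"
    by (rule fac_mor_Comp[OF _ _ _ fac_mor_runit_trivial])
      (simp_all add: fac_mor_tensor fac_mor_trivial fac_mor_Ident_unit)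
  show "fac_mor (trivial_fac (Dom C p) \<boxtimes> unit_fac)
      (p \<cdot> runit T\<^sub>1 (Dom C p)) (p \<cdot> runit mid_structure (Dom C p)) (p \<cdot> runit T\<^sub>2 (Dom C p))
      (trivial_fac (Cod C p))"
    by (rule fac_mor_Comp[OF _ _ _ _ fac_mor_runit_trivial]) (simp_all add: fac_mor_trivial)
qed (use nat_trans.naturality[OF nat_iso.axioms(1)[OF T1.runit_iso], of p "Dom C p" "Cod C p"]
      nat_trans.naturality[OF nat_iso.axioms(1)[OF T2.runit_iso], of p "Dom C p" "Cod C p"]
    in \<open>simp_all add: hom_iff\<close>)

lemma nat_iso_lunit_mid:
  "nat_iso C C \<lparr>fobj = (\<lambda>x. fobj P (I, x)), farr = (\<lambda>g. farr P (\<one> I, g))\<rparr> id_functor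
    (lunit mid_structure)"
proof (intro nat_iso.intro nat_trans.intro nat_trans_axioms.intro nat_iso_axioms.intro
    P.left_unit_functor id_functor)
  fix x
  assume "x \<in> Obj C"
  then show "iso C (lunit mid_structure x)"
    using fac_mor_iso(1)[OF _ _ fac_mor_lunit_trivial T1.constraint_iso(2) T2.constraint_iso(2)]
    by simp
qed (auto simp: hom_iff lunit_mid_natural)

lemma nat_iso_runit_mid:
  "nat_iso C C \<lparr>fobj = (\<lambda>x. fobj P (x, I)), farr = (\<lambda>g. farr P (g, \<one> I))\<rparr> id_functor
    (runit mid_structure)"
proof (intro nat_iso.intro nat_trans.intro nat_trans_axioms.intro nat_iso_axioms.intro
    P.right_unit_functor id_functor)
  fix x
  assume "x \<in> Obj C"
  then show "iso C (runit mid_structure x)"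
    using fac_mor_iso(1)[OF _ _ fac_mor_runit_trivial T1.constraint_iso(3) T2.constraint_iso(3)]
    by simp
qed (auto simp: hom_iff runit_mid_natural)

text \<open>The passage from objects to factorisations. The square of left halves extends from
  identities by naturality of the new associator, the target of \<open>e\<close> being
  \<open>P\<close>; the square of right halves extends by naturality of the associator of
  \<open>T\<^sub>2\<close>. This permits tensor products as arguments in the coherence laws.\<close>

lemma fac_mor_assoc:
  assumes F: "factorised F" and G: "factorised G" and H: "factorised H"
  shows "fac_mor ((F \<boxtimes> G) \<boxtimes> H)
    (assoc T\<^sub>1 (Dom C (fst F), Dom C (fst G), Dom C (fst H)))
    (assoc mid_structure (Cod C (fst F), Cod C (fst G), Cod C (fst H)))
    (assoc T\<^sub>2 (Cod C (snd F), Cod C (snd G), Cod C (snd H))) (F \<boxtimes> (G \<boxtimes> H))"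
proof -
  have "assoc mid_structure (Cod C (fst F), Cod C (fst G), Cod C (fst H)) \<cdot>
      E.diagonal (E.diagonal (fst F) (fst G)) (fst H)
    = E.diagonal (fst F) (E.diagonal (fst G) (fst H)) \<cdot>
      assoc T\<^sub>1 (Dom C (fst F), Dom C (fst G), Dom C (fst H))"
    by (rule E.diagonal_assoc[OF _ nat_iso.axioms(1)[OF nat_iso_assoc_mid]])
      (use F G H in \<open>simp_all add: hom_iff assoc_mid_coherence\<close>)
  moreover have "assoc T\<^sub>2 (Cod C (snd F), Cod C (snd G), Cod C (snd H)) \<cdot>
      M.diagonal (M.diagonal (snd F) (snd G)) (snd H)
    = M.diagonal (snd F) (M.diagonal (snd G) (snd H)) \<cdot>
      assoc mid_structure (Dom C (snd F), Dom C (snd G), Dom C (snd H))"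
    by (rule M.diagonal_assoc[OF _ nat_iso.axioms(1)[OF T2.assoc_iso]])
      (use F G H in \<open>simp_all add: hom_iff assoc_mid_coherence\<close>)
  ultimately show ?thesis
    using F G H by (simp add: fac_mor_def hom_iff)
qed

text \<open>Both sides of each coherence law are assembled as composites of morphisms of
  factorisations between the same ends; the outer equations are the pentagon and triangle of
  \<open>T\<^sub>1\<close> and \<open>T\<^sub>2\<close>.\<close>

lemma monoidal_mid_structure: "monoidal_category C mid_structure"
proof (intro monoidal_category.intro monoidal_category_axioms.intro)
  fix w x y z
  assume [simp]: "w \<in> Obj C" "x \<in> Obj C" "y \<in> Obj C" "z \<in> Obj C"
  let ?t = trivial_fac
  have "farr P (\<one> w, assoc mid_structure (x, y, z)) \<cdot> assoc mid_structure (w, fobj P (x, y), z) \<cdot>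
      farr P (assoc mid_structure (w, x, y), \<one> z)
    = assoc mid_structure (w, x, fobj P (y, z)) \<cdot> assoc mid_structure (fobj P (w, x), y, z)"
  proof (rule fac_mor_eq)
    show "fac_mor (((?t w \<boxtimes> ?t x) \<boxtimes> ?t y) \<boxtimes> ?t z)
        ((\<one> w \<otimes>\<^bsub>T\<^sub>1\<^esub> assoc T\<^sub>1 (x, y, z)) \<cdot> assoc T\<^sub>1 (w, x \<odot>\<^bsub>T\<^sub>1\<^esub> y, z) \<cdot> (assoc T\<^sub>1 (w, x, y) \<otimes>\<^bsub>T\<^sub>1\<^esub> \<one> z))
        (farr P (\<one> w, assoc mid_structure (x, y, z)) \<cdot> assoc mid_structure (w, fobj P (x, y), z) \<cdot>
          farr P (assoc mid_structure (w, x, y), \<one> z))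
        ((\<one> w \<otimes>\<^bsub>T\<^sub>2\<^esub> assoc T\<^sub>2 (x, y, z)) \<cdot> assoc T\<^sub>2 (w, x \<odot>\<^bsub>T\<^sub>2\<^esub> y, z) \<cdot> (assoc T\<^sub>2 (w, x, y) \<otimes>\<^bsub>T\<^sub>2\<^esub> \<one> z))
        (?t w \<boxtimes> (?t x \<boxtimes> (?t y \<boxtimes> ?t z)))"
      using fac_mor_Comp[OF _ _ _
          fac_mor_tensor[OF _ _ _ _ fac_mor_Ident_trivial[of w] fac_mor_assoc[of "?t x" "?t y" "?t z"]]
          fac_mor_Comp[OF _ _ _ fac_mor_assoc[of "?t w" "?t x \<boxtimes> ?t y" "?t z"]
            fac_mor_tensor[OF _ _ _ _ fac_mor_assoc[of "?t w" "?t x" "?t y"]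
              fac_mor_Ident_trivial[of z]]]]
      by simp
    show "fac_mor (((?t w \<boxtimes> ?t x) \<boxtimes> ?t y) \<boxtimes> ?t z)
        (assoc T\<^sub>1 (w, x, y \<odot>\<^bsub>T\<^sub>1\<^esub> z) \<cdot> assoc T\<^sub>1 (w \<odot>\<^bsub>T\<^sub>1\<^esub> x, y, z))
        (assoc mid_structure (w, x, fobj P (y, z)) \<cdot> assoc mid_structure (fobj P (w, x), y, z))
        (assoc T\<^sub>2 (w, x, y \<odot>\<^bsub>T\<^sub>2\<^esub> z) \<cdot> assoc T\<^sub>2 (w \<odot>\<^bsub>T\<^sub>2\<^esub> x, y, z))
        (?t w \<boxtimes> (?t x \<boxtimes> (?t y \<boxtimes> ?t z)))"
      using fac_mor_Comp[OF _ _ _ fac_mor_assoc[of "?t w" "?t x" "?t y \<boxtimes> ?t z"]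
        fac_mor_assoc[of "?t w \<boxtimes> ?t x" "?t y" "?t z"]]
      by simp
  qed (simp_all add: T1.pentagon T2.pentagon)
  then show "(\<one> w \<otimes>\<^bsub>mid_structure\<^esub> assoc mid_structure (x, y, z)) \<cdot>
      assoc mid_structure (w, x \<odot>\<^bsub>mid_structure\<^esub> y, z) \<cdot>
      (assoc mid_structure (w, x, y) \<otimes>\<^bsub>mid_structure\<^esub> \<one> z)
    = assoc mid_structure (w, x, y \<odot>\<^bsub>mid_structure\<^esub> z) \<cdot>
      assoc mid_structure (w \<odot>\<^bsub>mid_structure\<^esub> x, y, z)"
    by simp
next
  fix x y
  assume [simp]: "x \<in> Obj C" "y \<in> Obj C"
  let ?t = trivial_fac
  \<comment> \<open>The middle argument of this associator is \<open>unit_fac\<close>, so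
    \<open>fac_mor_assoc\<close> is required here as well: the three levels carry three unit
    objects.\<close>
  have "farr P (\<one> x, lunit mid_structure y) \<cdot> assoc mid_structure (x, I, y)
    = farr P (runit mid_structure x, \<one> y)"
  proof (rule fac_mor_eq)
    show "fac_mor ((?t x \<boxtimes> unit_fac) \<boxtimes> ?t y)
        ((\<one> x \<otimes>\<^bsub>T\<^sub>1\<^esub> lunit T\<^sub>1 y) \<cdot> assoc T\<^sub>1 (x, unit_obj T\<^sub>1, y))
        (farr P (\<one> x, lunit mid_structure y) \<cdot> assoc mid_structure (x, I, y))
        ((\<one> x \<otimes>\<^bsub>T\<^sub>2\<^esub> lunit T\<^sub>2 y) \<cdot> assoc T\<^sub>2 (x, unit_obj T\<^sub>2, y)) (?t x \<boxtimes> ?t y)"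
      using fac_mor_Comp[OF _ _ _ fac_mor_tensor[OF _ _ _ _ fac_mor_Ident_trivial
          fac_mor_lunit_trivial] fac_mor_assoc[of "?t x" unit_fac "?t y"]]
      by simp
    show "fac_mor ((?t x \<boxtimes> unit_fac) \<boxtimes> ?t y) (runit T\<^sub>1 x \<otimes>\<^bsub>T\<^sub>1\<^esub> \<one> y)
        (farr P (runit mid_structure x, \<one> y)) (runit T\<^sub>2 x \<otimes>\<^bsub>T\<^sub>2\<^esub> \<one> y) (?t x \<boxtimes> ?t y)"
      by (simp add: fac_mor_tensor fac_mor_Ident_trivial fac_mor_runit_trivial)
  qed (simp_all add: T1.triangle T2.triangle)
  then show "(\<one> x \<otimes>\<^bsub>mid_structure\<^esub> lunit mid_structure y) \<cdot>
      assoc mid_structure (x, unit_obj mid_structure, y)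
    = runit mid_structure x \<otimes>\<^bsub>mid_structure\<^esub> \<one> y"
    by simp
qed (simp_all add: category_axioms P.bifunctor nat_iso_assoc_mid nat_iso_lunit_mid
    nat_iso_runit_mid)

end

section \<open>Oplax structures on the two halves, and uniqueness of the constraints\<close>

context intermediate_comparison
begin

lemma oplax_left: "oplax_monoidal_functor C T\<^sub>1 C mid_structure id_functor e\<^sub>0 e"
  unfolding oplax_monoidal_id_iff
proof (intro conjI ballI)
  fix x y z
  assume [simp]: "x \<in> Obj C" "y \<in> Obj C" "z \<in> Obj C"
  show "lunit mid_structure x \<cdot> (e\<^sub>0 \<otimes>\<^bsub>mid_structure\<^esub> \<one> x) \<cdot> e (unit_obj T\<^sub>1, x) = lunit T\<^sub>1 x"
    using fac_mor_lunit_trivial[of x] by (simp add: fac_mor_def E.diagonal_def)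
  show "runit mid_structure x \<cdot> (\<one> x \<otimes>\<^bsub>mid_structure\<^esub> e\<^sub>0) \<cdot> e (x, unit_obj T\<^sub>1) = runit T\<^sub>1 x"
    using fac_mor_runit_trivial[of x] by (simp add: fac_mor_def E.diagonal_def)
  show "(\<one> x \<otimes>\<^bsub>mid_structure\<^esub> e (y, z)) \<cdot> e (x, y \<odot>\<^bsub>T\<^sub>1\<^esub> z) \<cdot> assoc T\<^sub>1 (x, y, z)
      = assoc mid_structure (x, y, z) \<cdot> (e (x, y) \<otimes>\<^bsub>mid_structure\<^esub> \<one> z) \<cdot> e (x \<odot>\<^bsub>T\<^sub>1\<^esub> y, z)"
    using assoc_mid_coherence(1)[of x y z] by (simp add: E.diagonal_def)
qed (use intermediate in \<open>simp_all add: T1.monoidal_category_axioms monoidal_mid_structure hom_iff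
      intermediate_tensor_def\<close>)

lemma oplax_right: "oplax_monoidal_functor C mid_structure C T\<^sub>2 id_functor m\<^sub>0 m"
  unfolding oplax_monoidal_id_iff
proof (intro conjI ballI)
  fix x y z
  assume [simp]: "x \<in> Obj C" "y \<in> Obj C" "z \<in> Obj C"
  show "lunit T\<^sub>2 x \<cdot> (m\<^sub>0 \<otimes>\<^bsub>T\<^sub>2\<^esub> \<one> x) \<cdot> m (unit_obj mid_structure, x) = lunit mid_structure x"
    using fac_mor_lunit_trivial[of x] by (simp add: fac_mor_def M.diagonal_def)
  show "runit T\<^sub>2 x \<cdot> (\<one> x \<otimes>\<^bsub>T\<^sub>2\<^esub> m\<^sub>0) \<cdot> m (x, unit_obj mid_structure) = runit mid_structure x"
    using fac_mor_runit_trivial[of x] by (simp add: fac_mor_def M.diagonal_def)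
  show "(\<one> x \<otimes>\<^bsub>T\<^sub>2\<^esub> m (y, z)) \<cdot> m (x, y \<odot>\<^bsub>mid_structure\<^esub> z) \<cdot> assoc mid_structure (x, y, z)
      = assoc T\<^sub>2 (x, y, z) \<cdot> (m (x, y) \<otimes>\<^bsub>T\<^sub>2\<^esub> \<one> z) \<cdot> m (x \<odot>\<^bsub>mid_structure\<^esub> y, z)"
    using assoc_mid_coherence(2)[of x y z] by (simp add: M.diagonal_def)
qed (use intermediate in \<open>simp_all add: T2.monoidal_category_axioms monoidal_mid_structure hom_iff
      intermediate_tensor_def\<close>)

lemma intermediate_mid_structure:
  "intermediate_monoidal C T\<^sub>1 T\<^sub>2 e\<^sub>0 e m\<^sub>0 m mid_structure"
  by (simp add: intermediate_monoidal_def monoidal_mid_structure oplax_left oplax_right)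

text \<open>The axioms assumed of \<open>T'\<close>, rewritten with diagonals, state that its
  constraints are middle components over the same outer constraints, so they compete with the
  fillers.\<close>

lemma intermediate_monoidal_unique:
  assumes T': "tensor T' = P" "unit_obj T' = I"
    and im: "intermediate_monoidal C T\<^sub>1 T\<^sub>2 e\<^sub>0 e m\<^sub>0 m T'"
    and [simp]: "x \<in> Obj C" "y \<in> Obj C" "z \<in> Obj C"
  shows "assoc T' (x, y, z) = assoc mid_structure (x, y, z)"
    and "lunit T' x = lunit mid_structure x"
    and "runit T' x = runit mid_structure x"
proof -
  interpret T': monoidal_category C T'
    using im by (simp add: intermediate_monoidal_def)
  note T'.constraint_simps [simplified T', simp]
  have l: "assoc T' (x, y, z) \<cdot> E.diagonal (E.diagonal (\<one> x) (\<one> y)) (\<one> z)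
        = E.diagonal (\<one> x) (E.diagonal (\<one> y) (\<one> z)) \<cdot> assoc T\<^sub>1 (x, y, z)"
      "lunit T' x \<cdot> E.diagonal e\<^sub>0 (\<one> x) = lunit T\<^sub>1 x"
      "runit T' x \<cdot> E.diagonal (\<one> x) e\<^sub>0 = runit T\<^sub>1 x"
    using im by (simp_all add: intermediate_monoidal_def oplax_monoidal_id_iff T' E.diagonal_def)
  have r: "assoc T\<^sub>2 (x, y, z) \<cdot> M.diagonal (M.diagonal (\<one> x) (\<one> y)) (\<one> z)
        = M.diagonal (\<one> x) (M.diagonal (\<one> y) (\<one> z)) \<cdot> assoc T' (x, y, z)"
      "lunit T\<^sub>2 x \<cdot> M.diagonal m\<^sub>0 (\<one> x) = lunit T' x"
      "runit T\<^sub>2 x \<cdot> M.diagonal (\<one> x) m\<^sub>0 = runit T' x"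
    using im by (simp_all add: intermediate_monoidal_def oplax_monoidal_id_iff T' M.diagonal_def)
  have "fac_mor (assoc_dom x y z) (assoc T\<^sub>1 (x, y, z)) (assoc T' (x, y, z)) (assoc T\<^sub>2 (x, y, z))
      (assoc_cod x y z)"
    using l r by (simp add: fac_mor_def hom_iff T')
  then show "assoc T' (x, y, z) = assoc mid_structure (x, y, z)"
    by (rule fac_mor_unique[OF _ _ _ fac_mor_assoc_trivial, rotated 2]) simp_all
  have "fac_mor (unit_fac \<boxtimes> trivial_fac x) (lunit T\<^sub>1 x) (lunit T' x) (lunit T\<^sub>2 x) (trivial_fac x)"
    using l r by (simp add: fac_mor_def hom_iff T')
  then show "lunit T' x = lunit mid_structure x"
    by (rule fac_mor_unique[OF _ _ _ fac_mor_lunit_trivial, rotated 2]) simp_all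
  have "fac_mor (trivial_fac x \<boxtimes> unit_fac) (runit T\<^sub>1 x) (runit T' x) (runit T\<^sub>2 x) (trivial_fac x)"
    using l r by (simp add: fac_mor_def hom_iff T')
  then show "runit T' x = runit mid_structure x"
    by (rule fac_mor_unique[OF _ _ _ fac_mor_runit_trivial, rotated 2]) simp_all
qed

end

section \<open>The intermediate braiding\<close>

locale intermediate_braided_comparison =
  intermediate_comparison C \<E> \<M> T\<^sub>1 T\<^sub>2 f\<^sub>0 f X e m I e\<^sub>0 m\<^sub>0 P +
  B1: braided_monoidal_category C T\<^sub>1 \<beta>\<^sub>1 + B2: braided_monoidal_category C T\<^sub>2 \<beta>\<^sub>2
  for C :: "('o, 'm) cat" (structure) and \<E> \<M> :: "'m set"
    and T\<^sub>1 T\<^sub>2 :: "('o, 'm) monoidal_structure"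
    and f\<^sub>0 :: 'm and f :: "'o \<times> 'o \<Rightarrow> 'm"
    and X :: "'o \<times> 'o \<Rightarrow> 'o" and e m :: "'o \<times> 'o \<Rightarrow> 'm"
    and I :: 'o and e\<^sub>0 m\<^sub>0 :: 'm
    and P :: "('o \<times> 'o, 'm \<times> 'm, 'o, 'm) ftor"
    and \<beta>\<^sub>1 \<beta>\<^sub>2 :: "'o \<times> 'o \<Rightarrow> 'm" +
  assumes oplax_braided: "oplax_braided_monoidal_functor C T\<^sub>1 \<beta>\<^sub>1 C T\<^sub>2 \<beta>\<^sub>2 id_functor f\<^sub>0 f"
begin

definition mid_braiding :: "'o \<times> 'o \<Rightarrow> 'm" where
  "mid_braiding = (\<lambda>(x, y). fac_fill (trivial_fac x \<boxtimes> trivial_fac y) (\<beta>\<^sub>1 (x, y)) (\<beta>\<^sub>2 (x, y))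
    (trivial_fac y \<boxtimes> trivial_fac x))"

text \<open>Diagonals at identities are just the components of \<open>f\<close>, so the outer square
  is literally the oplax braiding axiom.\<close>

lemma fac_mor_braiding_trivial:
  assumes "x \<in> Obj C" "y \<in> Obj C"
  shows "fac_mor (trivial_fac x \<boxtimes> trivial_fac y) (\<beta>\<^sub>1 (x, y)) (mid_braiding (x, y)) (\<beta>\<^sub>2 (x, y))
    (trivial_fac y \<boxtimes> trivial_fac x)"
proof -
  have "\<beta>\<^sub>2 (x, y) \<cdot> f (x, y) = f (y, x) \<cdot> \<beta>\<^sub>1 (x, y)"
    using oplax_braided[unfolded oplax_braided_id_iff] assms by blast
  then show ?thesis
    unfolding mid_braiding_def prod.case using assms
    by (intro fac_mor_fill) (simp_all add: hom_iff fac_tensor_composite F.diagonal_Ident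
        E.diagonal_Ident M.diagonal_Ident)
qed

lemma braiding_mid_simps [simp]:
  assumes "x \<in> Obj C" "y \<in> Obj C"
  shows "mid_braiding (x, y) \<in> Arr C" "Dom C (mid_braiding (x, y)) = fobj P (x, y)"
    "Cod C (mid_braiding (x, y)) = fobj P (y, x)"
  using fac_mor_braiding_trivial[OF assms] assms by (simp_all add: fac_mor_def hom_iff)

lemma braiding_mid_coherence:
  assumes "x \<in> Obj C" "y \<in> Obj C"
  shows "mid_braiding (x, y) \<cdot> E.diagonal (\<one> x) (\<one> y) = E.diagonal (\<one> y) (\<one> x) \<cdot> \<beta>\<^sub>1 (x, y)"
    and "\<beta>\<^sub>2 (x, y) \<cdot> M.diagonal (\<one> x) (\<one> y) = M.diagonal (\<one> y) (\<one> x) \<cdot> mid_braiding (x, y)"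
  using fac_mor_braiding_trivial[OF assms] by (simp_all add: fac_mor_def)

lemma braiding_mid_natural:
  assumes [simp]: "p \<in> Arr C" "q \<in> Arr C"
  shows "mid_braiding (Cod C p, Cod C q) \<cdot> farr P (p, q)
    = farr P (q, p) \<cdot> mid_braiding (Dom C p, Dom C q)"
proof (rule fac_mor_eq)
  let ?D = "\<lambda>g. trivial_fac (Dom C g)" and ?C = "\<lambda>g. trivial_fac (Cod C g)"
  note t = fac_mor_trivial[of p] fac_mor_trivial[of q]
  show "fac_mor (?D p \<boxtimes> ?D q) (\<beta>\<^sub>1 (Cod C p, Cod C q) \<cdot> (p \<otimes>\<^bsub>T\<^sub>1\<^esub> q))
      (mid_braiding (Cod C p, Cod C q) \<cdot> farr P (p, q)) (\<beta>\<^sub>2 (Cod C p, Cod C q) \<cdot> (p \<otimes>\<^bsub>T\<^sub>2\<^esub> q))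
      (?C q \<boxtimes> ?C p)"
    by (rule fac_mor_Comp[OF _ _ _ fac_mor_braiding_trivial]) (simp_all add: fac_mor_tensor t)
  show "fac_mor (?D p \<boxtimes> ?D q) ((q \<otimes>\<^bsub>T\<^sub>1\<^esub> p) \<cdot> \<beta>\<^sub>1 (Dom C p, Dom C q))
      (farr P (q, p) \<cdot> mid_braiding (Dom C p, Dom C q)) ((q \<otimes>\<^bsub>T\<^sub>2\<^esub> p) \<cdot> \<beta>\<^sub>2 (Dom C p, Dom C q))
      (?C q \<boxtimes> ?C p)"
    by (rule fac_mor_Comp[OF _ _ _ _ fac_mor_braiding_trivial]) (simp_all add: fac_mor_tensor t)
  have h: "(p, q) \<in> hom (C \<times>\<^sub>c C) (Dom C p, Dom C q) (Cod C p, Cod C q)"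
    by (simp add: hom_iff prod_cat_def)
  show "\<beta>\<^sub>1 (Cod C p, Cod C q) \<cdot> (p \<otimes>\<^bsub>T\<^sub>1\<^esub> q) = (q \<otimes>\<^bsub>T\<^sub>1\<^esub> p) \<cdot> \<beta>\<^sub>1 (Dom C p, Dom C q)"
    using nat_trans.naturality[OF nat_iso.axioms(1)[OF B1.braiding_iso] h] by simp
  show "\<beta>\<^sub>2 (Cod C p, Cod C q) \<cdot> (p \<otimes>\<^bsub>T\<^sub>2\<^esub> q) = (q \<otimes>\<^bsub>T\<^sub>2\<^esub> p) \<cdot> \<beta>\<^sub>2 (Dom C p, Dom C q)"
    using nat_trans.naturality[OF nat_iso.axioms(1)[OF B2.braiding_iso] h] by simp
qed simp_all

lemma nat_iso_braiding_mid:
  "nat_iso (C \<times>\<^sub>c C) C P \<lparr>fobj = (\<lambda>(x, y). fobj P (y, x)), farr = (\<lambda>(f, g). farr P (g, f))\<rparr>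
    mid_braiding"
proof (intro nat_iso.intro nat_trans.intro nat_trans_axioms.intro nat_iso_axioms.intro
    P.bifunctor P.swapped_functor)
  fix xy
  assume "xy \<in> Obj (C \<times>\<^sub>c C)"
  then obtain x y where [simp]: "xy = (x, y)" "x \<in> Obj C" "y \<in> Obj C"
    by (auto simp: prod_cat_def)
  show "iso C (mid_braiding xy)"
    using fac_mor_iso(1)[OF _ _ fac_mor_braiding_trivial B1.iso_braiding B2.iso_braiding] by simp
qed (auto simp: prod_cat_def hom_iff braiding_mid_natural)

text \<open>Extends the braiding to all factorisations, because each hexagon braids one object past
  a tensor product. The extension is by naturality of the new braiding on the left halves and of
  \<open>\<beta>\<^sub>2\<close> on the right halves.\<close>

lemma fac_mor_braiding:
  assumes F: "factorised F" and G: "factorised G"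
  shows "fac_mor (F \<boxtimes> G) (\<beta>\<^sub>1 (Dom C (fst F), Dom C (fst G)))
    (mid_braiding (Cod C (fst F), Cod C (fst G))) (\<beta>\<^sub>2 (Cod C (snd F), Cod C (snd G))) (G \<boxtimes> F)"
proof -
  have "mid_braiding (Cod C (fst F), Cod C (fst G)) \<cdot> E.diagonal (fst F) (fst G)
      = E.diagonal (fst G) (fst F) \<cdot> \<beta>\<^sub>1 (Dom C (fst F), Dom C (fst G))"
    by (rule E.diagonal_braiding[OF _ nat_iso.axioms(1)[OF nat_iso_braiding_mid]])
      (use F G in \<open>simp_all add: hom_iff braiding_mid_coherence\<close>)
  moreover have "\<beta>\<^sub>2 (Cod C (snd F), Cod C (snd G)) \<cdot> M.diagonal (snd F) (snd G)
      = M.diagonal (snd G) (snd F) \<cdot> mid_braiding (Dom C (snd F), Dom C (snd G))"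
    by (rule M.diagonal_braiding[OF _ nat_iso.axioms(1)[OF B2.braiding_iso]])
      (use F G in \<open>simp_all add: hom_iff braiding_mid_coherence\<close>)
  ultimately show ?thesis
    using F G by (simp add: fac_mor_def hom_iff)
qed

lemma fac_mor_inv_assoc:
  assumes "x \<in> Obj C" "y \<in> Obj C" "z \<in> Obj C"
  shows "fac_mor (assoc_cod x y z) (inv_arr C (assoc T\<^sub>1 (x, y, z)))
    (inv_arr C (assoc mid_structure (x, y, z))) (inv_arr C (assoc T\<^sub>2 (x, y, z))) (assoc_dom x y z)"
  using fac_mor_iso(2)[OF _ _ fac_mor_assoc_trivial T1.constraint_iso(1) T2.constraint_iso(1)] assms
  by simp

lemma braided_mid_structure: "braided_monoidal_category C mid_structure mid_braiding"
proof (intro braided_monoidal_category.intro braided_monoidal_category_axioms.intro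
    monoidal_mid_structure)
  fix x y z
  assume [simp]: "x \<in> Obj C" "y \<in> Obj C" "z \<in> Obj C"
  let ?t = trivial_fac
  have "assoc mid_structure (y, z, x) \<cdot> mid_braiding (x, fobj P (y, z)) \<cdot> assoc mid_structure (x, y, z)
      = farr P (\<one> y, mid_braiding (x, z)) \<cdot> assoc mid_structure (y, x, z) \<cdot>
        farr P (mid_braiding (x, y), \<one> z)"
  proof (rule fac_mor_eq)
    show "fac_mor ((?t x \<boxtimes> ?t y) \<boxtimes> ?t z)
        (assoc T\<^sub>1 (y, z, x) \<cdot> \<beta>\<^sub>1 (x, y \<odot>\<^bsub>T\<^sub>1\<^esub> z) \<cdot> assoc T\<^sub>1 (x, y, z))
        (assoc mid_structure (y, z, x) \<cdot> mid_braiding (x, fobj P (y, z)) \<cdot> assoc mid_structure (x, y, z))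
        (assoc T\<^sub>2 (y, z, x) \<cdot> \<beta>\<^sub>2 (x, y \<odot>\<^bsub>T\<^sub>2\<^esub> z) \<cdot> assoc T\<^sub>2 (x, y, z))
        (?t y \<boxtimes> (?t z \<boxtimes> ?t x))"
      \<comment> \<open>Only the braiding of \<open>x\<close> past
        \<open>?t y \<boxtimes> ?t z\<close> needs general factorisations; both associators here are
        at single objects.\<close>
      using fac_mor_Comp[OF _ _ _ fac_mor_assoc_trivial[of y z x]
          fac_mor_Comp[OF _ _ _ fac_mor_braiding[of "?t x" "?t y \<boxtimes> ?t z"]
            fac_mor_assoc_trivial[of x y z]]]
      by simp
    show "fac_mor ((?t x \<boxtimes> ?t y) \<boxtimes> ?t z)
        ((\<one> y \<otimes>\<^bsub>T\<^sub>1\<^esub> \<beta>\<^sub>1 (x, z)) \<cdot> assoc T\<^sub>1 (y, x, z) \<cdot> (\<beta>\<^sub>1 (x, y) \<otimes>\<^bsub>T\<^sub>1\<^esub> \<one> z))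
        (farr P (\<one> y, mid_braiding (x, z)) \<cdot> assoc mid_structure (y, x, z) \<cdot>
          farr P (mid_braiding (x, y), \<one> z))
        ((\<one> y \<otimes>\<^bsub>T\<^sub>2\<^esub> \<beta>\<^sub>2 (x, z)) \<cdot> assoc T\<^sub>2 (y, x, z) \<cdot> (\<beta>\<^sub>2 (x, y) \<otimes>\<^bsub>T\<^sub>2\<^esub> \<one> z))
        (?t y \<boxtimes> (?t z \<boxtimes> ?t x))"
      using fac_mor_Comp[OF _ _ _
          fac_mor_tensor[OF _ _ _ _ fac_mor_Ident_trivial[of y] fac_mor_braiding_trivial[of x z]]
          fac_mor_Comp[OF _ _ _ fac_mor_assoc_trivial[of y x z]
            fac_mor_tensor[OF _ _ _ _ fac_mor_braiding_trivial[of x y] fac_mor_Ident_trivial[of z]]]]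
      by simp
  qed (simp_all add: B1.hexagon B2.hexagon)
  then show "assoc mid_structure (y, z, x) \<cdot> mid_braiding (x, y \<odot>\<^bsub>mid_structure\<^esub> z) \<cdot>
      assoc mid_structure (x, y, z)
    = (\<one> y \<otimes>\<^bsub>mid_structure\<^esub> mid_braiding (x, z)) \<cdot> assoc mid_structure (y, x, z) \<cdot>
      (mid_braiding (x, y) \<otimes>\<^bsub>mid_structure\<^esub> \<one> z)"
    by simp
  have "inv_arr C (assoc mid_structure (z, x, y)) \<cdot> mid_braiding (fobj P (x, y), z) \<cdot>
        inv_arr C (assoc mid_structure (x, y, z))
      = farr P (mid_braiding (x, z), \<one> y) \<cdot> inv_arr C (assoc mid_structure (x, z, y)) \<cdot>
        farr P (\<one> x, mid_braiding (y, z))"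
  proof (rule fac_mor_eq)
    show "fac_mor (?t x \<boxtimes> (?t y \<boxtimes> ?t z))
        (inv_arr C (assoc T\<^sub>1 (z, x, y)) \<cdot> \<beta>\<^sub>1 (x \<odot>\<^bsub>T\<^sub>1\<^esub> y, z) \<cdot> inv_arr C (assoc T\<^sub>1 (x, y, z)))
        (inv_arr C (assoc mid_structure (z, x, y)) \<cdot> mid_braiding (fobj P (x, y), z) \<cdot>
          inv_arr C (assoc mid_structure (x, y, z)))
        (inv_arr C (assoc T\<^sub>2 (z, x, y)) \<cdot> \<beta>\<^sub>2 (x \<odot>\<^bsub>T\<^sub>2\<^esub> y, z) \<cdot> inv_arr C (assoc T\<^sub>2 (x, y, z)))
        ((?t z \<boxtimes> ?t x) \<boxtimes> ?t y)"
      \<comment> \<open>The inverse associators are middle components over the inverses of the outer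
        associators, so the pattern of the first hexagon carries over.\<close>
      using fac_mor_Comp[OF _ _ _ fac_mor_inv_assoc[of z x y]
          fac_mor_Comp[OF _ _ _ fac_mor_braiding[of "?t x \<boxtimes> ?t y" "?t z"]
            fac_mor_inv_assoc[of x y z]]]
      by simp
    show "fac_mor (?t x \<boxtimes> (?t y \<boxtimes> ?t z))
        ((\<beta>\<^sub>1 (x, z) \<otimes>\<^bsub>T\<^sub>1\<^esub> \<one> y) \<cdot> inv_arr C (assoc T\<^sub>1 (x, z, y)) \<cdot> (\<one> x \<otimes>\<^bsub>T\<^sub>1\<^esub> \<beta>\<^sub>1 (y, z)))
        (farr P (mid_braiding (x, z), \<one> y) \<cdot> inv_arr C (assoc mid_structure (x, z, y)) \<cdot>
          farr P (\<one> x, mid_braiding (y, z)))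
        ((\<beta>\<^sub>2 (x, z) \<otimes>\<^bsub>T\<^sub>2\<^esub> \<one> y) \<cdot> inv_arr C (assoc T\<^sub>2 (x, z, y)) \<cdot> (\<one> x \<otimes>\<^bsub>T\<^sub>2\<^esub> \<beta>\<^sub>2 (y, z)))
        ((?t z \<boxtimes> ?t x) \<boxtimes> ?t y)"
      using fac_mor_Comp[OF _ _ _
          fac_mor_tensor[OF _ _ _ _ fac_mor_braiding_trivial[of x z] fac_mor_Ident_trivial[of y]]
          fac_mor_Comp[OF _ _ _ fac_mor_inv_assoc[of x z y]
            fac_mor_tensor[OF _ _ _ _ fac_mor_Ident_trivial[of x] fac_mor_braiding_trivial[of y z]]]]
      by simp
  qed (simp_all add: B1.hexagon' B2.hexagon')
  then show "inv_arr C (assoc mid_structure (z, x, y)) \<cdot> mid_braiding (x \<odot>\<^bsub>mid_structure\<^esub> y, z) \<cdot>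
      inv_arr C (assoc mid_structure (x, y, z))
    = (mid_braiding (x, z) \<otimes>\<^bsub>mid_structure\<^esub> \<one> y) \<cdot> inv_arr C (assoc mid_structure (x, z, y)) \<cdot>
      (\<one> x \<otimes>\<^bsub>mid_structure\<^esub> mid_braiding (y, z))"
    by simp
qed (simp_all add: nat_iso_braiding_mid)

lemma oplax_braided_left:
  "oplax_braided_monoidal_functor C T\<^sub>1 \<beta>\<^sub>1 C mid_structure mid_braiding id_functor e\<^sub>0 e"
  unfolding oplax_braided_id_iff
  using braiding_mid_coherence(1)
  by (simp add: B1.braided_monoidal_category_axioms braided_mid_structure oplax_left
      E.diagonal_Ident)

lemma oplax_braided_right:
  "oplax_braided_monoidal_functor C mid_structure mid_braiding C T\<^sub>2 \<beta>\<^sub>2 id_functor m\<^sub>0 m"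
  unfolding oplax_braided_id_iff
  using braiding_mid_coherence(2)
  by (simp add: B2.braided_monoidal_category_axioms braided_mid_structure oplax_right
      M.diagonal_Ident)

lemma mid_braiding_unique:
  assumes l: "oplax_braided_monoidal_functor C T\<^sub>1 \<beta>\<^sub>1 C mid_structure \<beta> id_functor e\<^sub>0 e"
    and r: "oplax_braided_monoidal_functor C mid_structure \<beta> C T\<^sub>2 \<beta>\<^sub>2 id_functor m\<^sub>0 m"
    and [simp]: "x \<in> Obj C" "y \<in> Obj C"
  shows "\<beta> (x, y) = mid_braiding (x, y)"
proof -
  interpret B: braided_monoidal_category C mid_structure \<beta>
    using l by (simp add: oplax_braided_id_iff)
  have "fac_mor (trivial_fac x \<boxtimes> trivial_fac y) (\<beta>\<^sub>1 (x, y)) (\<beta> (x, y)) (\<beta>\<^sub>2 (x, y))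
      (trivial_fac y \<boxtimes> trivial_fac x)"
    using l r by (simp add: oplax_braided_id_iff fac_mor_def hom_iff E.diagonal_Ident M.diagonal_Ident)
  then show ?thesis
    by (rule fac_mor_unique[OF _ _ _ fac_mor_braiding_trivial, rotated 2]) simp_all
qed

text \<open>The double braiding is an endomorphism of \<open>?F\<close> whose outer components are
  identities by symmetry of \<open>\<beta>\<^sub>1\<close> and
  \<open>\<beta>\<^sub>2\<close>.\<close>

lemma symmetric_mid_structure:
  assumes "symmetric_monoidal_category C T\<^sub>1 \<beta>\<^sub>1" "symmetric_monoidal_category C T\<^sub>2 \<beta>\<^sub>2"
  shows "symmetric_monoidal_category C mid_structure mid_braiding"
proof (intro symmetric_monoidal_category.intro symmetric_monoidal_category_axioms.intro
    braided_mid_structure)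
  fix x y
  assume [simp]: "x \<in> Obj C" "y \<in> Obj C"
  let ?F = "trivial_fac x \<boxtimes> trivial_fac y"
  have "mid_braiding (y, x) \<cdot> mid_braiding (x, y) = \<one> (fobj P (x, y))"
  proof (rule fac_mor_eq)
    show "fac_mor ?F (\<beta>\<^sub>1 (y, x) \<cdot> \<beta>\<^sub>1 (x, y)) (mid_braiding (y, x) \<cdot> mid_braiding (x, y))
        (\<beta>\<^sub>2 (y, x) \<cdot> \<beta>\<^sub>2 (x, y)) ?F"
      by (rule fac_mor_Comp[OF _ _ _ fac_mor_braiding_trivial fac_mor_braiding_trivial]) simp_all
    show "fac_mor ?F (\<one> (x \<odot>\<^bsub>T\<^sub>1\<^esub> y)) (\<one> (fobj P (x, y))) (\<one> (x \<odot>\<^bsub>T\<^sub>2\<^esub> y)) ?F"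
      using fac_mor_Ident[of ?F] by simp
  qed (simp_all add: symmetric_monoidal_category.symmetry[OF assms(1)]
      symmetric_monoidal_category.symmetry[OF assms(2)])
  then show "mid_braiding (y, x) \<cdot> mid_braiding (x, y) = \<one> (x \<odot>\<^bsub>mid_structure\<^esub> y)"
    by simp
qed

end

section \<open>Existence and uniqueness over every intermediate tensor functor\<close>

theorem theorem1p6:
  fixes C :: "('o, 'm) cat"
    and T\<^sub>1 T\<^sub>2 :: "('o, 'm) monoidal_structure"
    and f\<^sub>0 :: 'm and f :: "'o \<times> 'o \<Rightarrow> 'm"
    and \<E> \<M> :: "'m set"
    and X :: "'o \<times> 'o \<Rightarrow> 'o" and e m :: "'o \<times> 'o \<Rightarrow> 'm"
    and I :: 'o and e\<^sub>0 m\<^sub>0 :: 'm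
  assumes "category C"
    and "monoidal_category C T\<^sub>1"
    and "monoidal_category C T\<^sub>2"
    and "oplax_monoidal_functor C T\<^sub>1 C T\<^sub>2 id_functor f\<^sub>0 f"
    and "orthogonal_factorisation_system C \<E> \<M>"
    and "\<And>g h. g \<in> \<E> \<Longrightarrow> h \<in> \<E> \<Longrightarrow> g \<otimes>\<^bsub>T\<^sub>1\<^esub> h \<in> \<E>"
    and "\<And>g h. g \<in> \<M> \<Longrightarrow> h \<in> \<M> \<Longrightarrow> g \<otimes>\<^bsub>T\<^sub>2\<^esub> h \<in> \<M>"
    and "\<And>x y. x \<in> Obj C \<Longrightarrow> y \<in> Obj C \<Longrightarrow>
          e (x, y) \<in> \<E> \<and> e (x, y) \<in> hom C (x \<odot>\<^bsub>T\<^sub>1\<^esub> y) (X (x, y)) \<and>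
          m (x, y) \<in> \<M> \<and> m (x, y) \<in> hom C (X (x, y)) (x \<odot>\<^bsub>T\<^sub>2\<^esub> y) \<and>
          m (x, y) \<cdot>\<^bsub>C\<^esub> e (x, y) = f (x, y)"
    and "e\<^sub>0 \<in> \<E> \<and> e\<^sub>0 \<in> hom C (unit_obj T\<^sub>1) I \<and>
         m\<^sub>0 \<in> \<M> \<and> m\<^sub>0 \<in> hom C I (unit_obj T\<^sub>2) \<and>
         m\<^sub>0 \<cdot>\<^bsub>C\<^esub> e\<^sub>0 = f\<^sub>0"
  shows "I \<in> Obj C \<and>
    (\<exists>P. intermediate_tensor C T\<^sub>1 T\<^sub>2 X e m P) \<and>
    (\<forall>P. intermediate_tensor C T\<^sub>1 T\<^sub>2 X e m P \<longrightarrow>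
      (\<exists>T. tensor T = P \<and> unit_obj T = I \<and>
        intermediate_monoidal C T\<^sub>1 T\<^sub>2 e\<^sub>0 e m\<^sub>0 m T \<and>
        (\<forall>T'. tensor T' = P \<and> unit_obj T' = I \<and>
            intermediate_monoidal C T\<^sub>1 T\<^sub>2 e\<^sub>0 e m\<^sub>0 m T' \<longrightarrow>
          (\<forall>x \<in> Obj C. \<forall>y \<in> Obj C. \<forall>z \<in> Obj C. assoc T' (x, y, z) = assoc T (x, y, z)) \<and>
          (\<forall>x \<in> Obj C. lunit T' x = lunit T x) \<and>
          (\<forall>x \<in> Obj C. runit T' x = runit T x)) \<and>
        (\<forall>\<beta>\<^sub>1 \<beta>\<^sub>2.
          braided_monoidal_category C T\<^sub>1 \<beta>\<^sub>1 \<and> braided_monoidal_category C T\<^sub>2 \<beta>\<^sub>2 \<and>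
          oplax_braided_monoidal_functor C T\<^sub>1 \<beta>\<^sub>1 C T\<^sub>2 \<beta>\<^sub>2 id_functor f\<^sub>0 f \<longrightarrow>
          (\<exists>\<beta>. braided_monoidal_category C T \<beta> \<and>
            oplax_braided_monoidal_functor C T\<^sub>1 \<beta>\<^sub>1 C T \<beta> id_functor e\<^sub>0 e \<and>
            oplax_braided_monoidal_functor C T \<beta> C T\<^sub>2 \<beta>\<^sub>2 id_functor m\<^sub>0 m \<and>
            (\<forall>\<beta>'. braided_monoidal_category C T \<beta>' \<and>
                oplax_braided_monoidal_functor C T\<^sub>1 \<beta>\<^sub>1 C T \<beta>' id_functor e\<^sub>0 e \<and>
                oplax_braided_monoidal_functor C T \<beta>' C T\<^sub>2 \<beta>\<^sub>2 id_functor m\<^sub>0 m \<longrightarrow>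
              (\<forall>x \<in> Obj C. \<forall>y \<in> Obj C. \<beta>' (x, y) = \<beta> (x, y))))) \<and>
        (\<forall>\<beta>\<^sub>1 \<beta>\<^sub>2.
          symmetric_monoidal_category C T\<^sub>1 \<beta>\<^sub>1 \<and> symmetric_monoidal_category C T\<^sub>2 \<beta>\<^sub>2 \<and>
          oplax_symmetric_monoidal_functor C T\<^sub>1 \<beta>\<^sub>1 C T\<^sub>2 \<beta>\<^sub>2 id_functor f\<^sub>0 f \<longrightarrow>
          (\<exists>\<beta>. symmetric_monoidal_category C T \<beta> \<and>
            oplax_symmetric_monoidal_functor C T\<^sub>1 \<beta>\<^sub>1 C T \<beta> id_functor e\<^sub>0 e \<and>
            oplax_symmetric_monoidal_functor C T \<beta> C T\<^sub>2 \<beta>\<^sub>2 id_functor m\<^sub>0 m \<and>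
            (\<forall>\<beta>'. symmetric_monoidal_category C T \<beta>' \<and>
                oplax_symmetric_monoidal_functor C T\<^sub>1 \<beta>\<^sub>1 C T \<beta>' id_functor e\<^sub>0 e \<and>
                oplax_symmetric_monoidal_functor C T \<beta>' C T\<^sub>2 \<beta>\<^sub>2 id_functor m\<^sub>0 m \<longrightarrow>
              (\<forall>x \<in> Obj C. \<forall>y \<in> Obj C. \<beta>' (x, y) = \<beta> (x, y)))))))"
proof -
  interpret factorised_comparison C \<E> \<M> T\<^sub>1 T\<^sub>2 f\<^sub>0 f X e m I e\<^sub>0 m\<^sub>0
    using assms
    by (intro factorised_comparison.intro factorised_comparison_axioms.intro) blast+
  show ?thesis
  proof (intro conjI allI impI)
    show "I \<in> Obj C" by simp
    show "\<exists>P. intermediate_tensor C T\<^sub>1 T\<^sub>2 X e m P"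
      using intermediate_fill_tensor by blast
  next
    fix P
    assume P: "intermediate_tensor C T\<^sub>1 T\<^sub>2 X e m P"
    interpret intermediate_comparison C \<E> \<M> T\<^sub>1 T\<^sub>2 f\<^sub>0 f X e m I e\<^sub>0 m\<^sub>0 P
      by unfold_locales (rule P)
    \<comment> \<open>The oplax hypothesis already contains that both outer structures are braided,
      so the braided and the symmetric clause can enter the same locale.\<close>
    have braided: "intermediate_braided_comparison C \<E> \<M> T\<^sub>1 T\<^sub>2 f\<^sub>0 f X e m I e\<^sub>0 m\<^sub>0 P \<beta>\<^sub>1 \<beta>\<^sub>2"
      if "oplax_braided_monoidal_functor C T\<^sub>1 \<beta>\<^sub>1 C T\<^sub>2 \<beta>\<^sub>2 id_functor f\<^sub>0 f" for \<beta>\<^sub>1 \<beta>\<^sub>2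
    proof -
      have "braided_monoidal_category C T\<^sub>1 \<beta>\<^sub>1" "braided_monoidal_category C T\<^sub>2 \<beta>\<^sub>2"
        using that unfolding oplax_braided_id_iff by blast+
      then show ?thesis
        using that intermediate_comparison_axioms
        by (intro intermediate_braided_comparison.intro
            intermediate_braided_comparison_axioms.intro)
    qed
    show "\<exists>T. tensor T = P \<and> unit_obj T = I \<and>
        intermediate_monoidal C T\<^sub>1 T\<^sub>2 e\<^sub>0 e m\<^sub>0 m T \<and>
        (\<forall>T'. tensor T' = P \<and> unit_obj T' = I \<and>
            intermediate_monoidal C T\<^sub>1 T\<^sub>2 e\<^sub>0 e m\<^sub>0 m T' \<longrightarrow>
          (\<forall>x \<in> Obj C. \<forall>y \<in> Obj C. \<forall>z \<in> Obj C. assoc T' (x, y, z) = assoc T (x, y, z)) \<and>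
          (\<forall>x \<in> Obj C. lunit T' x = lunit T x) \<and>
          (\<forall>x \<in> Obj C. runit T' x = runit T x)) \<and>
        (\<forall>\<beta>\<^sub>1 \<beta>\<^sub>2.
          braided_monoidal_category C T\<^sub>1 \<beta>\<^sub>1 \<and> braided_monoidal_category C T\<^sub>2 \<beta>\<^sub>2 \<and>
          oplax_braided_monoidal_functor C T\<^sub>1 \<beta>\<^sub>1 C T\<^sub>2 \<beta>\<^sub>2 id_functor f\<^sub>0 f \<longrightarrow>
          (\<exists>\<beta>. braided_monoidal_category C T \<beta> \<and>
            oplax_braided_monoidal_functor C T\<^sub>1 \<beta>\<^sub>1 C T \<beta> id_functor e\<^sub>0 e \<and>
            oplax_braided_monoidal_functor C T \<beta> C T\<^sub>2 \<beta>\<^sub>2 id_functor m\<^sub>0 m \<and>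
            (\<forall>\<beta>'. braided_monoidal_category C T \<beta>' \<and>
                oplax_braided_monoidal_functor C T\<^sub>1 \<beta>\<^sub>1 C T \<beta>' id_functor e\<^sub>0 e \<and>
                oplax_braided_monoidal_functor C T \<beta>' C T\<^sub>2 \<beta>\<^sub>2 id_functor m\<^sub>0 m \<longrightarrow>
              (\<forall>x \<in> Obj C. \<forall>y \<in> Obj C. \<beta>' (x, y) = \<beta> (x, y))))) \<and>
        (\<forall>\<beta>\<^sub>1 \<beta>\<^sub>2.
          symmetric_monoidal_category C T\<^sub>1 \<beta>\<^sub>1 \<and> symmetric_monoidal_category C T\<^sub>2 \<beta>\<^sub>2 \<and>
          oplax_symmetric_monoidal_functor C T\<^sub>1 \<beta>\<^sub>1 C T\<^sub>2 \<beta>\<^sub>2 id_functor f\<^sub>0 f \<longrightarrow>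
          (\<exists>\<beta>. symmetric_monoidal_category C T \<beta> \<and>
            oplax_symmetric_monoidal_functor C T\<^sub>1 \<beta>\<^sub>1 C T \<beta> id_functor e\<^sub>0 e \<and>
            oplax_symmetric_monoidal_functor C T \<beta> C T\<^sub>2 \<beta>\<^sub>2 id_functor m\<^sub>0 m \<and>
            (\<forall>\<beta>'. symmetric_monoidal_category C T \<beta>' \<and>
                oplax_symmetric_monoidal_functor C T\<^sub>1 \<beta>\<^sub>1 C T \<beta>' id_functor e\<^sub>0 e \<and>
                oplax_symmetric_monoidal_functor C T \<beta>' C T\<^sub>2 \<beta>\<^sub>2 id_functor m\<^sub>0 m \<longrightarrow>
              (\<forall>x \<in> Obj C. \<forall>y \<in> Obj C. \<beta>' (x, y) = \<beta> (x, y)))))"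
    \<comment> \<open>One witness serves all clauses: the braiding and the symmetry are claimed on
      the same monoidal structure whose uniqueness is asserted.\<close>
    proof (intro exI[of _ mid_structure] conjI allI impI)
      show "tensor mid_structure = P" "unit_obj mid_structure = I" by simp_all
      show "intermediate_monoidal C T\<^sub>1 T\<^sub>2 e\<^sub>0 e m\<^sub>0 m mid_structure"
        by (rule intermediate_mid_structure)
    next
      fix T'
      assume "tensor T' = P \<and> unit_obj T' = I \<and> intermediate_monoidal C T\<^sub>1 T\<^sub>2 e\<^sub>0 e m\<^sub>0 m T'"
      then show "\<forall>x \<in> Obj C. \<forall>y \<in> Obj C. \<forall>z \<in> Obj C.
          assoc T' (x, y, z) = assoc mid_structure (x, y, z)"
        and "\<forall>x \<in> Obj C. lunit T' x = lunit mid_structure x"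
        and "\<forall>x \<in> Obj C. runit T' x = runit mid_structure x"
        using intermediate_monoidal_unique by blast+
    next
      fix \<beta>\<^sub>1 \<beta>\<^sub>2
      assume "braided_monoidal_category C T\<^sub>1 \<beta>\<^sub>1 \<and> braided_monoidal_category C T\<^sub>2 \<beta>\<^sub>2 \<and>
        oplax_braided_monoidal_functor C T\<^sub>1 \<beta>\<^sub>1 C T\<^sub>2 \<beta>\<^sub>2 id_functor f\<^sub>0 f"
      then interpret intermediate_braided_comparison C \<E> \<M> T\<^sub>1 T\<^sub>2 f\<^sub>0 f X e m I e\<^sub>0 m\<^sub>0 P \<beta>\<^sub>1 \<beta>\<^sub>2
        using braided by blast
      show "\<exists>\<beta>. braided_monoidal_category C mid_structure \<beta> \<and>
            oplax_braided_monoidal_functor C T\<^sub>1 \<beta>\<^sub>1 C mid_structure \<beta> id_functor e\<^sub>0 e \<and>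
            oplax_braided_monoidal_functor C mid_structure \<beta> C T\<^sub>2 \<beta>\<^sub>2 id_functor m\<^sub>0 m \<and>
            (\<forall>\<beta>'. braided_monoidal_category C mid_structure \<beta>' \<and>
                oplax_braided_monoidal_functor C T\<^sub>1 \<beta>\<^sub>1 C mid_structure \<beta>' id_functor e\<^sub>0 e \<and>
                oplax_braided_monoidal_functor C mid_structure \<beta>' C T\<^sub>2 \<beta>\<^sub>2 id_functor m\<^sub>0 m \<longrightarrow>
              (\<forall>x \<in> Obj C. \<forall>y \<in> Obj C. \<beta>' (x, y) = \<beta> (x, y)))"
        using braided_mid_structure oplax_braided_left oplax_braided_right mid_braiding_unique
        by blast
    next
      fix \<beta>\<^sub>1 \<beta>\<^sub>2
      assume s: "symmetric_monoidal_category C T\<^sub>1 \<beta>\<^sub>1 \<and> symmetric_monoidal_category C T\<^sub>2 \<beta>\<^sub>2 \<and>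
        oplax_symmetric_monoidal_functor C T\<^sub>1 \<beta>\<^sub>1 C T\<^sub>2 \<beta>\<^sub>2 id_functor f\<^sub>0 f"
      then have "oplax_braided_monoidal_functor C T\<^sub>1 \<beta>\<^sub>1 C T\<^sub>2 \<beta>\<^sub>2 id_functor f\<^sub>0 f"
        unfolding oplax_symmetric_iff by blast
      then interpret intermediate_braided_comparison C \<E> \<M> T\<^sub>1 T\<^sub>2 f\<^sub>0 f X e m I e\<^sub>0 m\<^sub>0 P \<beta>\<^sub>1 \<beta>\<^sub>2
        by (rule braided)
      show "\<exists>\<beta>. symmetric_monoidal_category C mid_structure \<beta> \<and>
            oplax_symmetric_monoidal_functor C T\<^sub>1 \<beta>\<^sub>1 C mid_structure \<beta> id_functor e\<^sub>0 e \<and>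
            oplax_symmetric_monoidal_functor C mid_structure \<beta> C T\<^sub>2 \<beta>\<^sub>2 id_functor m\<^sub>0 m \<and>
            (\<forall>\<beta>'. symmetric_monoidal_category C mid_structure \<beta>' \<and>
                oplax_symmetric_monoidal_functor C T\<^sub>1 \<beta>\<^sub>1 C mid_structure \<beta>' id_functor e\<^sub>0 e \<and>
                oplax_symmetric_monoidal_functor C mid_structure \<beta>' C T\<^sub>2 \<beta>\<^sub>2 id_functor m\<^sub>0 m \<longrightarrow>
              (\<forall>x \<in> Obj C. \<forall>y \<in> Obj C. \<beta>' (x, y) = \<beta> (x, y)))"
        \<comment> \<open>A competing symmetry is in particular a competing braiding, so
          \<open>mid_braiding_unique\<close> also settles uniqueness here.\<close>
        unfolding oplax_symmetric_iff
        using s symmetric_mid_structure oplax_braided_left oplax_braided_right mid_braiding_unique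
        by blast
    qed
  qed
qed

end
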